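(* Let $\mathcal{C}$ be a congruence-modular and semi-degenerate variety such that, for each member $M$ of $\mathcal{C}$, $\mathcal{K}(M)$ is closed with respect to the commutator of $M$. Let $A$ be a member of $\mathcal{C}$. Then, for any $\theta\in\mathrm{Con}(A)$, the lattices $\mathcal{L}(A/\theta)$ and $\mathcal{L}(A)/\theta^*$ are isomorphic.
   Context: $\mathcal{C}$ is a variety (equational class) of algebras of some signature; congruence-modular means every member has a modular congruence lattice; semi-degenerate means no non-trivial algebra in $\mathcal{C}$ has one-element subalgebras (equivalently, $\nabla_M$ is a compact congruence for all members $M$). For a member $M$, $\mathrm{Con}(M)$ is the complete lattice of congruences of $M$, with meet $\cap$, join $\vee$, least element $\Delta_M$ and greatest element $\nabla_M=M^2$; $\mathcal{K}(M)$ is the set of finitely generated (equivalently, compact) congruences of $M$. Commutator: for $\alpha,\beta,\mu\in\mathrm{Con}(M)$, $C(\alpha,\beta;\mu)$ means: for all $n,k\in\mathbb{N}$ and every term $t$ of arity $n+k$, if $(a_i,b_i)\in\alpha$ for $1\le i\le n$ and $(c_j,d_j)\in\beta$ for $1\le j\le k$, then $(t^M(\vec a,\vec c),t^M(\vec a,\vec d))\in\mu$ iff $(t^M(\vec b,\vec c),t^M(\vec b,\vec d))\in\mu$. Put $[\alpha,\beta]_M=\bigcap\{\mu\mid C(\alpha,\beta;\mu)\}$. In a congruence-modular variety it is commutative and distributive with respect to arbitrary joins in both arguments. A congruence $\phi\neq\nabla_M$ is prime iff $[\alpha,\beta]_M\subseteq\phi$ implies $\alpha\subseteq\phi$ or $\beta\subseteq\phi$;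 $\mathrm{Spec}(M)$ is the set of prime congruences; $\rho_M(\theta)=\bigcap\{\phi\in\mathrm{Spec}(M)\mid\theta\subseteq\phi\}$ (empty intersection $=\nabla_M$); $\alpha\equiv_M\beta$ iff $\rho_M(\alpha)=\rho_M(\beta)$; $\widehat\alpha$ is the $\equiv_M$-class of $\alpha$. $\mathcal{L}(M)=\{\widehat\alpha\mid\alpha\in\mathcal{K}(M)\}$ is a bounded distributive lattice with $\widehat\alpha\vee\widehat\beta=\widehat{\alpha\vee\beta}$, $\widehat\alpha\wedge\widehat\beta=\widehat{[\alpha,\beta]_M}$, $\mathbf 0=\widehat{\Delta_M}$, $\mathbf 1=\widehat{\nabla_M}$. $\theta^*=\{\widehat\alpha\mid\alpha\in\mathcal{K}(A),\alpha\subseteq\theta\}$, an ideal of $\mathcal{L}(A)$. For a distributive lattice $L$ and an ideal $I$ of $L$, $L/I$ is the quotient of $L$ by the lattice congruence $x\sim y$ iff $x\vee i=y\vee i$ for some $i\in I$. *)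

theory Defs
  imports "HOL-Algebra.Congruence"
begin

section \<open>Algebras, terms and varieties\<close>

text \<open>A signature is a set \<open>F\<close> of pairs (symbol, arity). It may be empty or infinite, and the same
  name used with two arities stands for two symbols. Membership \<open>(f, length ts) \<in> F\<close> is the
  arity check for terms and for operations.\<close>

datatype ('f, uvars: 'v) uterm = Var 'v | Op 'f "('f, 'v) uterm list"

fun wf_term :: "('f \<times> nat) set \<Rightarrow> ('f, 'v) uterm \<Rightarrow> bool" where
  "wf_term F (Var x) \<longleftrightarrow> True"
| "wf_term F (Op f ts) \<longleftrightarrow> (f, length ts) \<in> F \<and> (\<forall>t\<in>set ts. wf_term F t)"

record ('f, 'a) algebra = "'a partial_object" +
  interp :: "'f \<Rightarrow> 'a list \<Rightarrow> 'a"

primrec eval_term :: "('f, 'a, 'x) algebra_scheme \<Rightarrow> ('v \<Rightarrow> 'a) \<Rightarrow> ('f, 'v) uterm \<Rightarrow> 'a" where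
  "eval_term M v (Var x) = v x"
| "eval_term M v (Op f ts) = interp M f (map (eval_term M v) ts)"

definition closed_under :: "('f \<times> nat) set \<Rightarrow> ('f, 'a) algebra \<Rightarrow> 'a set \<Rightarrow> bool" where
  "closed_under F M S \<longleftrightarrow>
     (\<forall>f xs. (f, length xs) \<in> F \<and> set xs \<subseteq> S \<longrightarrow> interp M f xs \<in> S)"

definition is_algebra :: "('f \<times> nat) set \<Rightarrow> ('f, 'a) algebra \<Rightarrow> bool" where
  "is_algebra F M \<longleftrightarrow> carrier M \<noteq> {} \<and> closed_under F M (carrier M)"

definition subalgebra :: "('f \<times> nat) set \<Rightarrow> ('f, 'a) algebra \<Rightarrow> 'a set \<Rightarrow> bool" where
  "subalgebra F M S \<longleftrightarrow> S \<noteq> {} \<and> S \<subseteq> carrier M \<and> closed_under F M S"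

type_synonym 'f identities = "(('f, nat) uterm \<times> ('f, nat) uterm) set"

definition wf_identities :: "('f \<times> nat) set \<Rightarrow> 'f identities \<Rightarrow> bool" where
  "wf_identities F E \<longleftrightarrow> (\<forall>(s, t)\<in>E. wf_term F s \<and> wf_term F t)"

definition variety :: "('f \<times> nat) set \<Rightarrow> 'f identities \<Rightarrow> ('f, 'a) algebra set" where
  "variety F E = {M. is_algebra F M \<and>
     (\<forall>(s, t)\<in>E. \<forall>v. range v \<subseteq> carrier M \<longrightarrow> eval_term M v s = eval_term M v t)}"

text \<open>HOL cannot quantify over the carrier type inside a formula, so a hypothesis about all members
  of a variety is stated for the members whose carrier lies in one fixed large type. For a given
  algebra on \<open>'a\<close> we take the following type: it contains isomorphic copies of the algebra itself,
  of its finite powers and their subalgebras and quotients, and of the free algebras of the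
  variety on \<open>'a\<close>, on \<open>nat\<close> or on \<open>'a + nat\<close> generators (as sets of classes of terms).
  A hypothesis restricted to this type is implied by the same hypothesis on all
  members of the variety.\<close>

type_synonym ('f, 'a) universe = "('f, 'a + nat) uterm set"


section \<open>Congruences\<close>

definition Con :: "('f \<times> nat) set \<Rightarrow> ('f, 'a) algebra \<Rightarrow> 'a rel set" where
  "Con F M = {\<theta>. equiv (carrier M) \<theta> \<and>
     (\<forall>f xs ys. (f, length xs) \<in> F \<and> list_all2 (\<lambda>x y. (x, y) \<in> \<theta>) xs ys \<longrightarrow>
        (interp M f xs, interp M f ys) \<in> \<theta>)}"

abbreviation nabla :: "('f, 'a) algebra \<Rightarrow> 'a rel" where
  "nabla M \<equiv> carrier M \<times> carrier M"

definition Cg :: "('f \<times> nat) set \<Rightarrow> ('f, 'a) algebra \<Rightarrow> 'a rel \<Rightarrow> 'a rel" where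
  "Cg F M X = \<Inter>{\<theta> \<in> Con F M. X \<subseteq> \<theta>}"

definition cjoin :: "('f \<times> nat) set \<Rightarrow> ('f, 'a) algebra \<Rightarrow> 'a rel \<Rightarrow> 'a rel \<Rightarrow> 'a rel" where
  "cjoin F M \<alpha> \<beta> = Cg F M (\<alpha> \<union> \<beta>)"

definition fg_con :: "('f \<times> nat) set \<Rightarrow> ('f, 'a) algebra \<Rightarrow> 'a rel set" where
  "fg_con F M = {Cg F M X | X. finite X \<and> X \<subseteq> nabla M}"

definition congruence_modular :: "('f \<times> nat) set \<Rightarrow> ('f, 'a) algebra set \<Rightarrow> bool" where
  "congruence_modular F \<C> \<longleftrightarrow> (\<forall>M\<in>\<C>. \<forall>\<alpha>\<in>Con F M. \<forall>\<beta>\<in>Con F M. \<forall>\<gamma>\<in>Con F M.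
     \<alpha> \<subseteq> \<gamma> \<longrightarrow> cjoin F M \<alpha> (\<beta> \<inter> \<gamma>) = cjoin F M \<alpha> \<beta> \<inter> \<gamma>)"

definition semi_degenerate :: "('f \<times> nat) set \<Rightarrow> ('f, 'a) algebra set \<Rightarrow> bool" where
  "semi_degenerate F \<C> \<longleftrightarrow>
     (\<forall>M\<in>\<C>. (\<exists>x y. x \<in> carrier M \<and> y \<in> carrier M \<and> x \<noteq> y) \<longrightarrow>
        \<not> (\<exists>x. subalgebra F M {x}))"

definition quotient_algebra :: "('f, 'a) algebra \<Rightarrow> 'a rel \<Rightarrow> ('f, 'a set) algebra" where
  "quotient_algebra M \<theta> = \<lparr>carrier = carrier M // \<theta>,
     interp = (\<lambda>f Xs. \<Union>{\<theta> `` {interp M f xs} | xs. list_all2 (\<in>) xs Xs})\<rparr>"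


section \<open>Commutator and prime congruences\<close>

text \<open>A term of arity \<open>n + k\<close> is a well-formed term with variables below \<open>n + k\<close>; it is evaluated
  at the concatenation of the two argument lists.\<close>

definition term_op :: "('f, 'a) algebra \<Rightarrow> ('f, nat) uterm \<Rightarrow> 'a list \<Rightarrow> 'a" where
  "term_op M t xs = eval_term M (\<lambda>i. xs ! i) t"

definition centralizes ::
    "('f \<times> nat) set \<Rightarrow> ('f, 'a) algebra \<Rightarrow> 'a rel \<Rightarrow> 'a rel \<Rightarrow> 'a rel \<Rightarrow> bool" where
  "centralizes F M \<alpha> \<beta> \<mu> \<longleftrightarrow>
     (\<forall>n k t as bs cs ds.
        wf_term F t \<and> uvars t \<subseteq> {..<n + k} \<and>
        length as = n \<and> length bs = n \<and> length cs = k \<and> length ds = k \<and>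
        (\<forall>i<n. (as ! i, bs ! i) \<in> \<alpha>) \<and> (\<forall>j<k. (cs ! j, ds ! j) \<in> \<beta>) \<longrightarrow>
        ((term_op M t (as @ cs), term_op M t (as @ ds)) \<in> \<mu> \<longleftrightarrow>
         (term_op M t (bs @ cs), term_op M t (bs @ ds)) \<in> \<mu>))"

definition commutator ::
    "('f \<times> nat) set \<Rightarrow> ('f, 'a) algebra \<Rightarrow> 'a rel \<Rightarrow> 'a rel \<Rightarrow> 'a rel" where
  "commutator F M \<alpha> \<beta> = \<Inter>{\<mu> \<in> Con F M. centralizes F M \<alpha> \<beta> \<mu>}"

definition Spec :: "('f \<times> nat) set \<Rightarrow> ('f, 'a) algebra \<Rightarrow> 'a rel set" where
  "Spec F M = {\<phi> \<in> Con F M. \<phi> \<noteq> nabla M \<and>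
     (\<forall>\<alpha>\<in>Con F M. \<forall>\<beta>\<in>Con F M. commutator F M \<alpha> \<beta> \<subseteq> \<phi> \<longrightarrow> \<alpha> \<subseteq> \<phi> \<or> \<beta> \<subseteq> \<phi>)}"

text \<open>Intersecting with \<open>nabla M\<close> gives the empty intersection its intended value.\<close>

definition radical :: "('f \<times> nat) set \<Rightarrow> ('f, 'a) algebra \<Rightarrow> 'a rel \<Rightarrow> 'a rel" where
  "radical F M \<theta> = nabla M \<inter> \<Inter>{\<phi> \<in> Spec F M. \<theta> \<subseteq> \<phi>}"

definition hat :: "('f \<times> nat) set \<Rightarrow> ('f, 'a) algebra \<Rightarrow> 'a rel \<Rightarrow> 'a rel set" where
  "hat F M \<alpha> = {\<beta> \<in> Con F M. radical F M \<beta> = radical F M \<alpha>}"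


section \<open>Lattices as algebraic structures\<close>

record 'a lat = "'a partial_object" +
  ljoin :: "'a \<Rightarrow> 'a \<Rightarrow> 'a"
  lmeet :: "'a \<Rightarrow> 'a \<Rightarrow> 'a"

definition is_lattice :: "'a lat \<Rightarrow> bool" where
  "is_lattice L \<longleftrightarrow>
     (\<forall>x\<in>carrier L. \<forall>y\<in>carrier L.
        ljoin L x y \<in> carrier L \<and> lmeet L x y \<in> carrier L \<and>
        ljoin L x y = ljoin L y x \<and> lmeet L x y = lmeet L y x \<and>
        ljoin L x (lmeet L x y) = x \<and> lmeet L x (ljoin L x y) = x \<and>
        (\<forall>z\<in>carrier L. ljoin L (ljoin L x y) z = ljoin L x (ljoin L y z) \<and>
                        lmeet L (lmeet L x y) z = lmeet L x (lmeet L y z)))"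

definition lattice_isomorphic :: "'a lat \<Rightarrow> 'b lat \<Rightarrow> bool" where
  "lattice_isomorphic L L' \<longleftrightarrow> is_lattice L \<and> is_lattice L' \<and>
     (\<exists>h. bij_betw h (carrier L) (carrier L') \<and>
        (\<forall>x\<in>carrier L. \<forall>y\<in>carrier L.
           h (ljoin L x y) = ljoin L' (h x) (h y) \<and> h (lmeet L x y) = lmeet L' (h x) (h y)))"

definition ideal_rel :: "'a lat \<Rightarrow> 'a set \<Rightarrow> 'a rel" where
  "ideal_rel L I = {(x, y). x \<in> carrier L \<and> y \<in> carrier L \<and> (\<exists>i\<in>I. ljoin L x i = ljoin L y i)}"

text \<open>Operations on classes, here and in \<open>reticulation\<close>, are unions over all choices of
  representatives. When the operation does not depend on representatives, this union is the class
  of the result.\<close>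

definition quotient_lattice :: "'a lat \<Rightarrow> 'a set \<Rightarrow> 'a set lat" where
  "quotient_lattice L I = \<lparr>carrier = carrier L // ideal_rel L I,
     ljoin = (\<lambda>X Y. \<Union>x\<in>X. \<Union>y\<in>Y. ideal_rel L I `` {ljoin L x y}),
     lmeet = (\<lambda>X Y. \<Union>x\<in>X. \<Union>y\<in>Y. ideal_rel L I `` {lmeet L x y})\<rparr>"


section \<open>The reticulation\<close>

definition reticulation :: "('f \<times> nat) set \<Rightarrow> ('f, 'a) algebra \<Rightarrow> 'a rel set lat" where
  "reticulation F M = \<lparr>carrier = hat F M ` fg_con F M,
     ljoin = (\<lambda>X Y. \<Union>\<alpha>\<in>X \<inter> fg_con F M. \<Union>\<beta>\<in>Y \<inter> fg_con F M. hat F M (cjoin F M \<alpha> \<beta>)),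
     lmeet = (\<lambda>X Y. \<Union>\<alpha>\<in>X \<inter> fg_con F M. \<Union>\<beta>\<in>Y \<inter> fg_con F M. hat F M (commutator F M \<alpha> \<beta>))\<rparr>"

definition star :: "('f \<times> nat) set \<Rightarrow> ('f, 'a) algebra \<Rightarrow> 'a rel \<Rightarrow> 'a rel set set" where
  "star F M \<theta> = {hat F M \<alpha> | \<alpha>. \<alpha> \<in> fg_con F M \<and> \<alpha> \<subseteq> \<theta>}"

end

theory Submission
  imports Defs
begin

text \<open>Primes of \<open>A/\<theta>\<close> correspond to primes of \<open>A\<close> above \<open>\<theta>\<close>, so \<open>\<alpha> \<mapsto> (\<alpha> \<or> \<theta>)/\<theta>\<close> induces a lattice
  homomorphism of \<open>\<L>(A)\<close> onto \<open>\<L>(A/\<theta>)\<close>, and its kernel has to be the congruence of the ideal \<open>\<theta>\<^sup>*\<close>.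
  If \<open>\<alpha>\<close> lies in the radical of \<open>\<beta> \<or> \<theta>\<close>, then by Zorn's lemma some commutator power of \<open>\<alpha>\<close> lies in
  \<open>\<beta> \<or> \<theta>\<close>; the power is compact, hence lies in \<open>\<beta> \<or> \<gamma>\<close> for a compact \<open>\<gamma> \<subseteq> \<theta>\<close>, and so \<open>\<alpha>\<close> is in the
  radical of \<open>\<beta> \<or> \<gamma>\<close>. Both the correspondence of primes and the Zorn argument rest on one consequence
  of modularity, derived from Day's terms: \<open>[\<alpha>,\<beta>] \<subseteq> \<phi>\<close> implies \<open>C(\<alpha> \<or> \<phi>, \<beta> \<or> \<phi>; \<phi>)\<close>.\<close>

section \<open>Terms and congruences\<close>

text \<open>Two obstacles shape the development. The hypotheses on the variety speak only about
  algebras whose carrier lies in the type \<open>universe\<close>, whereas \<open>A\<close> lives on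
  \<open>'a\<close>. Modularity is therefore used only in a relatively free algebra built from
  terms, and it leaves that algebra as Day's identities, which hold in \<open>A\<close> itself;
  closure of the compact congruences under the commutator is carried to \<open>A\<close> along an
  injection of \<open>'a\<close> into \<open>universe\<close>. The second obstacle is that the
  commutator of a quotient is hard to compare with that of \<open>A\<close>: for a surjection, the
  easy inclusion goes one way only. No formula for it is proved; the elements of both reticulations
  are handled through sets of primes. Writing V(\<alpha>) for the set of primes above \<alpha>, the
  class of \<alpha> is determined by V(\<alpha>), joins become intersections and commutators become
  unions. The lattice laws are then set algebra, and passing from A to A/\<theta> amounts to
  intersecting with V(\<theta>).\<close>

lemma list_all2_trancl_steps:
  assumes "list_all2 (\<lambda>x y. (x, y) \<in> R\<^sup>+) xs ys"
    and "R \<subseteq> C \<times> C" and "trans S" and "set xs \<subseteq> C"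
    and refl: "\<And>us. set us \<subseteq> C \<Longrightarrow> length us = length xs \<Longrightarrow> (g us, g us) \<in> S"
    and step: "\<And>pre x y suf. (x, y) \<in> R \<Longrightarrow> set pre \<subseteq> C \<Longrightarrow> set suf \<subseteq> C \<Longrightarrow>
      length (pre @ x # suf) = length xs \<Longrightarrow> (g (pre @ x # suf), g (pre @ y # suf)) \<in> S"
  shows "(g xs, g ys) \<in> S"
proof -
  have RC: "R\<^sup>+ \<subseteq> C \<times> C"
    using assms(2) by (rule trancl_subset_Sigma)
  \<comment> \<open>Entries are exchanged from left to right: \<open>pre\<close> holds those already
    exchanged, and the chain of \<open>R\<close>-steps runs in the first remaining entry
    only.\<close>
  have "set pre \<subseteq> C \<Longrightarrow> set us \<subseteq> C \<Longrightarrow> length (pre @ us) = length xs \<Longrightarrow>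
      (g (pre @ us), g (pre @ vs)) \<in> S"
    if "list_all2 (\<lambda>x y. (x, y) \<in> R\<^sup>+) us vs" for us vs pre
    using that
  proof (induction us vs arbitrary: pre rule: list_all2_induct)
    case Nil
    then show ?case using refl by simp
  next
    case (Cons x us y vs)
    have us: "set us \<subseteq> C" and y: "y \<in> C"
      using Cons.prems Cons.hyps(1) RC by auto
    have "(g (pre @ x # us), g (pre @ y # us)) \<in> S"
      using Cons.hyps(1)
    proof (induction rule: trancl_induct)
      case (base y)
      then show ?case
        using step[OF base Cons.prems(1) us] Cons.prems by simp
    next
      case (step y z)
      then show ?case
        using assms(6)[OF step.hyps(2) Cons.prems(1) us] Cons.prems assms(3)
        by (auto dest: transD)
    qed
    moreover have "(g ((pre @ [y]) @ us), g ((pre @ [y]) @ vs)) \<in> S"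
      using Cons.IH[of "pre @ [y]"] Cons.prems y by simp
    ultimately show ?case using assms(3) by (auto dest: transD)
  qed
  from this[OF assms(1), of "[]"] show ?thesis using assms(4) by simp
qed

lemma eval_term_cong:
  "(\<And>x. x \<in> uvars t \<Longrightarrow> v x = w x) \<Longrightarrow> eval_term M v t = eval_term M w t"
proof (induction t)
  case (Op f ts)
  then have "map (eval_term M v) ts = map (eval_term M w) ts"
    by (intro map_cong[OF refl]) auto
  then show ?case by (simp only: eval_term.simps)
qed simp

lemma finite_uvars: "finite (uvars t)"
  by (induction t) auto

abbreviation term_algebra :: "('f \<times> nat) set \<Rightarrow> ('f, ('f, 'v) uterm) algebra" where
  "term_algebra F \<equiv> \<lparr>carrier = {t. wf_term F t}, interp = Op\<rparr>"

text \<open>Substitution is evaluation in the absolutely free algebra. Evaluation looks only at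
  \<open>interp\<close>, so the empty signature serves for every \<open>F\<close>.\<close>

abbreviation subst :: "('v \<Rightarrow> ('f, 'w) uterm) \<Rightarrow> ('f, 'v) uterm \<Rightarrow> ('f, 'w) uterm" where
  "subst \<equiv> eval_term (term_algebra {})"

lemma eval_subst: "eval_term M v (subst \<sigma> t) = eval_term M (\<lambda>x. eval_term M v (\<sigma> x)) t"
  by (induction t) (simp_all add: o_def cong: map_cong)

lemma uvars_subst: "uvars (subst \<sigma> t) = (\<Union>x\<in>uvars t. uvars (\<sigma> x))"
  by (induction t) auto

lemma wf_subst: "wf_term F t \<Longrightarrow> (\<And>x. x \<in> uvars t \<Longrightarrow> wf_term F (\<sigma> x)) \<Longrightarrow> wf_term F (subst \<sigma> t)"
  by (induction t) auto

section \<open>Congruences and their closure properties\<close>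

lemma Con_equiv: "\<theta> \<in> Con F M \<Longrightarrow> equiv (carrier M) \<theta>"
  by (simp add: Con_def)

lemma Con_refl: "\<theta> \<in> Con F M \<Longrightarrow> x \<in> carrier M \<Longrightarrow> (x, x) \<in> \<theta>"
  by (meson Con_equiv equivE refl_onD)

lemma Con_sym: "\<theta> \<in> Con F M \<Longrightarrow> (x, y) \<in> \<theta> \<Longrightarrow> (y, x) \<in> \<theta>"
  by (meson Con_equiv equivE symD)

lemma Con_trans: "\<theta> \<in> Con F M \<Longrightarrow> (x, y) \<in> \<theta> \<Longrightarrow> (y, z) \<in> \<theta> \<Longrightarrow> (x, z) \<in> \<theta>"
  by (meson Con_equiv equivE transD)

lemma Con_subset: "\<theta> \<in> Con F M \<Longrightarrow> \<theta> \<subseteq> nabla M"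
  using Con_equiv equiv_type by blast

lemma Con_carrier: "\<theta> \<in> Con F M \<Longrightarrow> (x, y) \<in> \<theta> \<Longrightarrow> x \<in> carrier M \<and> y \<in> carrier M"
  using Con_subset by blast

lemma Con_interp:
  "\<theta> \<in> Con F M \<Longrightarrow> (f, length xs) \<in> F \<Longrightarrow> list_all2 (\<lambda>x y. (x, y) \<in> \<theta>) xs ys \<Longrightarrow>
    (interp M f xs, interp M f ys) \<in> \<theta>"
  by (simp add: Con_def)

lemma Con_list_refl:
  "\<theta> \<in> Con F M \<Longrightarrow> set us \<subseteq> carrier M \<Longrightarrow> list_all2 (\<lambda>x y. (x, y) \<in> \<theta>) us us"
  by (induction us) (auto intro: Con_refl)

lemma ConI:
  assumes "\<theta> \<subseteq> nabla M" "\<And>x. x \<in> carrier M \<Longrightarrow> (x, x) \<in> \<theta>"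
    "\<And>x y. (x, y) \<in> \<theta> \<Longrightarrow> (y, x) \<in> \<theta>"
    "\<And>x y z. (x, y) \<in> \<theta> \<Longrightarrow> (y, z) \<in> \<theta> \<Longrightarrow> (x, z) \<in> \<theta>"
    "\<And>f xs ys. (f, length xs) \<in> F \<Longrightarrow> list_all2 (\<lambda>x y. (x, y) \<in> \<theta>) xs ys \<Longrightarrow>
      (interp M f xs, interp M f ys) \<in> \<theta>"
  shows "\<theta> \<in> Con F M"
  unfolding Con_def equiv_def refl_on_def sym_def trans_def using assms by blast

lemma Con_eval_term:
  assumes "\<theta> \<in> Con F M"
  shows "wf_term F t \<Longrightarrow> (\<And>x. x \<in> uvars t \<Longrightarrow> (v x, w x) \<in> \<theta>) \<Longrightarrow>
    (eval_term M v t, eval_term M w t) \<in> \<theta>"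
proof (induction t)
  case (Var x)
  then show ?case by simp
next
  case (Op f ts)
  then have "\<forall>t\<in>set ts. (eval_term M v t, eval_term M w t) \<in> \<theta>" by auto
  then have "list_all2 (\<lambda>x y. (x, y) \<in> \<theta>) (map (eval_term M v) ts) (map (eval_term M w) ts)"
    by (simp add: list.rel_map list.rel_refl_strong)
  with Op.prems show ?case by (auto intro!: Con_interp[OF assms])
qed

lemma eval_term_closed:
  assumes "is_algebra F M"
  shows "wf_term F t \<Longrightarrow> (\<And>x. x \<in> uvars t \<Longrightarrow> v x \<in> carrier M) \<Longrightarrow> eval_term M v t \<in> carrier M"
proof (induction t)
  case (Op f ts)
  then have "set (map (eval_term M v) ts) \<subseteq> carrier M" by auto
  with Op.prems assms show ?case
    unfolding is_algebra_def closed_under_def by fastforce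
qed simp

lemma Inter_Con:
  assumes "\<S> \<noteq> {}" "\<S> \<subseteq> Con F M"
  shows "\<Inter>\<S> \<in> Con F M"
proof (rule ConI)
  show "\<Inter>\<S> \<subseteq> nabla M" using assms Con_subset by blast
  show "(interp M f xs, interp M f ys) \<in> \<Inter>\<S>"
    if "(f, length xs) \<in> F" "list_all2 (\<lambda>x y. (x, y) \<in> \<Inter>\<S>) xs ys" for f xs ys
  proof
    fix \<theta> assume "\<theta> \<in> \<S>"
    then have "list_all2 (\<lambda>x y. (x, y) \<in> \<theta>) xs ys"
      using list_all2_mono[OF that(2), of "\<lambda>x y. (x, y) \<in> \<theta>"] by blast
    with \<open>\<theta> \<in> \<S>\<close> that(1) assms(2) show "(interp M f xs, interp M f ys) \<in> \<theta>"
      by (intro Con_interp[of \<theta> F]) auto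
  qed
  show "(x, x) \<in> \<Inter>\<S>" if "x \<in> carrier M" for x
    using that assms(2) by (auto intro!: Con_refl[of _ F])
  show "(y, x) \<in> \<Inter>\<S>" if "(x, y) \<in> \<Inter>\<S>" for x y
    using that assms(2) by (auto intro!: Con_sym[of _ F M x y])
  show "(x, z) \<in> \<Inter>\<S>" if "(x, y) \<in> \<Inter>\<S>" "(y, z) \<in> \<Inter>\<S>" for x y z
  proof
    fix \<theta> assume "\<theta> \<in> \<S>"
    with that assms(2) show "(x, z) \<in> \<theta>" by (intro Con_trans[of \<theta> F M x y z]) auto
  qed
qed

lemma Inter_Con2: "\<alpha> \<in> Con F M \<Longrightarrow> \<beta> \<in> Con F M \<Longrightarrow> \<alpha> \<inter> \<beta> \<in> Con F M"
  using Inter_Con[of "{\<alpha>, \<beta>}" F M] by simp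

text \<open>Stated for directed families, since it serves both the chains of Zorn's lemma and the
  approximation of a join by finitely generated pieces.\<close>

lemma directed_Union_Con:
  assumes "\<S> \<noteq> {}" "\<S> \<subseteq> Con F M" "\<And>\<alpha> \<beta>. \<alpha> \<in> \<S> \<Longrightarrow> \<beta> \<in> \<S> \<Longrightarrow> \<exists>\<gamma>\<in>\<S>. \<alpha> \<union> \<beta> \<subseteq> \<gamma>"
  shows "\<Union>\<S> \<in> Con F M"
proof (rule ConI)
  show "(x, z) \<in> \<Union>\<S>" if xyz: "(x, y) \<in> \<Union>\<S>" "(y, z) \<in> \<Union>\<S>" for x y z
  proof -
    obtain \<alpha> \<beta> where "(x, y) \<in> \<alpha>" "(y, z) \<in> \<beta>" "\<alpha> \<in> \<S>" "\<beta> \<in> \<S>"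
      using xyz by auto
    moreover obtain \<gamma> where "\<alpha> \<union> \<beta> \<subseteq> \<gamma>" "\<gamma> \<in> \<S>"
      using assms(3)[OF \<open>\<alpha> \<in> \<S>\<close> \<open>\<beta> \<in> \<S>\<close>] by blast
    ultimately have "(x, y) \<in> \<gamma>" "(y, z) \<in> \<gamma>" "\<gamma> \<in> \<S>" by (simp_all add: subset_iff)
    with assms(2) have "(x, z) \<in> \<gamma>" by (meson Con_trans subsetD)
    with \<open>\<gamma> \<in> \<S>\<close> show ?thesis by blast
  qed
  show "(interp M f xs, interp M f ys) \<in> \<Union>\<S>"
    if "(f, length xs) \<in> F" "list_all2 (\<lambda>x y. (x, y) \<in> \<Union>\<S>) xs ys" for f xs ys
  proof -
    \<comment> \<open>Finitely many argument pairs fit into one member of the directed family; for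
      nullary operations this needs the family to be nonempty.\<close>
    from that(2) have "\<exists>\<theta>\<in>\<S>. list_all2 (\<lambda>x y. (x, y) \<in> \<theta>) xs ys"
    proof (induction rule: list_all2_induct)
      case Nil
      then show ?case using assms(1) by auto
    next
      case (Cons x xs y ys)
      then obtain \<alpha> \<beta> where xy: "(x, y) \<in> \<alpha>" and l: "list_all2 (\<lambda>x y. (x, y) \<in> \<beta>) xs ys"
        and "\<alpha> \<in> \<S>" "\<beta> \<in> \<S>"
        by blast
      obtain \<gamma> where \<gamma>: "\<alpha> \<union> \<beta> \<subseteq> \<gamma>" "\<gamma> \<in> \<S>"
        using assms(3)[OF \<open>\<alpha> \<in> \<S>\<close> \<open>\<beta> \<in> \<S>\<close>] by blast
      have "list_all2 (\<lambda>x y. (x, y) \<in> \<gamma>) xs ys"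
        using list_all2_mono[OF l, of "\<lambda>x y. (x, y) \<in> \<gamma>"] \<gamma>(1) by blast
      with xy \<gamma> show ?case by auto
    qed
    with that(1) assms(2) show ?thesis by (blast intro: Con_interp)
  qed
  show "\<Union>\<S> \<subseteq> nabla M" using assms(2) Con_subset by blast
  show "(x, x) \<in> \<Union>\<S>" if "x \<in> carrier M" for x
    using that assms(1,2) by (auto intro!: Con_refl[of _ F])
  show "(y, x) \<in> \<Union>\<S>" if "(x, y) \<in> \<Union>\<S>" for x y
    using that assms(2) by (auto intro!: bexI Con_sym[of _ F M x y])
qed

section \<open>Congruence generation and the term condition\<close>

locale univ_algebra =
  fixes F :: "('f \<times> nat) set" and M :: "('f, 'a) algebra"
  assumes is_algebra: "is_algebra F M"
begin

lemma nabla_Con: "nabla M \<in> Con F M"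
proof (rule ConI)
  show "(interp M f xs, interp M f ys) \<in> nabla M"
    if "(f, length xs) \<in> F" "list_all2 (\<lambda>x y. (x, y) \<in> nabla M) xs ys" for f xs ys
  proof -
    from that(2) have "set xs \<subseteq> carrier M" "set ys \<subseteq> carrier M" "length ys = length xs"
      by (induction rule: list_all2_induct) auto
    with that(1) is_algebra show ?thesis
      unfolding is_algebra_def closed_under_def by auto
  qed
qed auto

lemma Cg_Con: "X \<subseteq> nabla M \<Longrightarrow> Cg F M X \<in> Con F M"
  unfolding Cg_def by (rule Inter_Con) (use nabla_Con in auto)

lemma Cg_superset: "X \<subseteq> Cg F M X"
  unfolding Cg_def by auto

lemma Cg_least: "\<theta> \<in> Con F M \<Longrightarrow> X \<subseteq> \<theta> \<Longrightarrow> Cg F M X \<subseteq> \<theta>"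
  unfolding Cg_def by auto

lemma Cg_subset_iff: "\<theta> \<in> Con F M \<Longrightarrow> Cg F M X \<subseteq> \<theta> \<longleftrightarrow> X \<subseteq> \<theta>"
  using Cg_least Cg_superset by blast

lemma fg_con_Con: "\<alpha> \<in> fg_con F M \<Longrightarrow> \<alpha> \<in> Con F M"
  unfolding fg_con_def using Cg_Con by auto

lemma cjoin_Con: "\<alpha> \<in> Con F M \<Longrightarrow> \<beta> \<in> Con F M \<Longrightarrow> cjoin F M \<alpha> \<beta> \<in> Con F M"
  unfolding cjoin_def by (intro Cg_Con) (auto dest: Con_carrier)

lemma cjoin_subset_iff: "\<theta> \<in> Con F M \<Longrightarrow> cjoin F M \<alpha> \<beta> \<subseteq> \<theta> \<longleftrightarrow> \<alpha> \<subseteq> \<theta> \<and> \<beta> \<subseteq> \<theta>"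
  by (simp add: cjoin_def Cg_subset_iff)

lemma cjoin_ge: "\<alpha> \<subseteq> cjoin F M \<alpha> \<beta>" "\<beta> \<subseteq> cjoin F M \<alpha> \<beta>"
  unfolding cjoin_def using Cg_superset by blast+

lemma cjoin_Cg:
  assumes "X \<subseteq> nabla M" "Y \<subseteq> nabla M"
  shows "cjoin F M (Cg F M X) (Cg F M Y) = Cg F M (X \<union> Y)"
proof
  show "cjoin F M (Cg F M X) (Cg F M Y) \<subseteq> Cg F M (X \<union> Y)"
    using assms Cg_superset[of "X \<union> Y"] by (auto simp: cjoin_subset_iff Cg_Con Cg_subset_iff)
  show "Cg F M (X \<union> Y) \<subseteq> cjoin F M (Cg F M X) (Cg F M Y)"
    using Cg_superset cjoin_ge assms
    by (intro Cg_least cjoin_Con Cg_Con) blast+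
qed

lemma cjoin_fg_con:
  assumes "\<alpha> \<in> fg_con F M" "\<beta> \<in> fg_con F M"
  shows "cjoin F M \<alpha> \<beta> \<in> fg_con F M"
proof -
  obtain X Y where "finite X" "X \<subseteq> nabla M" "\<alpha> = Cg F M X" "finite Y" "Y \<subseteq> nabla M" "\<beta> = Cg F M Y"
    using assms unfolding fg_con_def by auto
  then have "cjoin F M \<alpha> \<beta> = Cg F M (X \<union> Y)" "finite (X \<union> Y)" "X \<union> Y \<subseteq> nabla M"
    by (simp_all add: cjoin_Cg)
  then show ?thesis unfolding fg_con_def by blast
qed

text \<open>Both congruences are reflexive, so changing one argument of an operation along one of
  them is a single step, and a tuple is changed entry by entry. The closure is
  \<open>trancl\<close>, since \<open>rtrancl\<close> would also relate points outside the
  carrier.\<close>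

lemma cjoin_eq_trancl:
  assumes "\<alpha> \<in> Con F M" "\<beta> \<in> Con F M"
  shows "cjoin F M \<alpha> \<beta> = (\<alpha> \<union> \<beta>)\<^sup>+"
proof
  have R: "\<alpha> \<union> \<beta> \<subseteq> nabla M" using assms Con_subset by blast
  note RC = trancl_subset_Sigma[OF R]
  have "(\<alpha> \<union> \<beta>)\<^sup>+ \<in> Con F M"
  proof (rule ConI)
    show "(\<alpha> \<union> \<beta>)\<^sup>+ \<subseteq> nabla M" using RC .
    show "(x, x) \<in> (\<alpha> \<union> \<beta>)\<^sup>+" if "x \<in> carrier M" for x
      using that Con_refl[OF assms(1)] by blast
    have "sym (\<alpha> \<union> \<beta>)" using assms by (auto intro!: symI dest: Con_sym)
    then show "(y, x) \<in> (\<alpha> \<union> \<beta>)\<^sup>+" if "(x, y) \<in> (\<alpha> \<union> \<beta>)\<^sup>+" for x y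
      using that by (meson sym_trancl symD)
    show "(x, z) \<in> (\<alpha> \<union> \<beta>)\<^sup>+" if "(x, y) \<in> (\<alpha> \<union> \<beta>)\<^sup>+" "(y, z) \<in> (\<alpha> \<union> \<beta>)\<^sup>+" for x y z
      using that by (rule trancl_trans)
    show "(interp M f xs, interp M f ys) \<in> (\<alpha> \<union> \<beta>)\<^sup>+"
      if f: "(f, length xs) \<in> F" and l: "list_all2 (\<lambda>x y. (x, y) \<in> (\<alpha> \<union> \<beta>)\<^sup>+) xs ys" for f xs ys
    proof (rule list_all2_trancl_steps[OF l R trans_trancl])
      show "set xs \<subseteq> carrier M" using l RC by (induction rule: list_all2_induct) auto
      show "(interp M f us, interp M f us) \<in> (\<alpha> \<union> \<beta>)\<^sup>+"
        if "set us \<subseteq> carrier M" "length us = length xs" for us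
        using Con_interp[OF assms(1) _ Con_list_refl[OF assms(1)], of f us] that f by auto
      show "(interp M f (pre @ x # suf), interp M f (pre @ y # suf)) \<in> (\<alpha> \<union> \<beta>)\<^sup>+"
        if xy: "(x, y) \<in> \<alpha> \<union> \<beta>" and C: "set pre \<subseteq> carrier M" "set suf \<subseteq> carrier M"
          and len: "length (pre @ x # suf) = length xs" for pre x y suf
      proof -
        have "(interp M f (pre @ x # suf), interp M f (pre @ y # suf)) \<in> \<gamma>"
          if "(x, y) \<in> \<gamma>" "\<gamma> \<in> Con F M" for \<gamma>
          using that C len f by (intro Con_interp[of \<gamma> F] list_all2_appendI list.rel_intros
            Con_list_refl[OF that(2)]) auto
        with xy assms show ?thesis by blast
      qed
    qed
  qed
  then show "cjoin F M \<alpha> \<beta> \<subseteq> (\<alpha> \<union> \<beta>)\<^sup>+"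
    unfolding cjoin_def by (intro Cg_least) auto
  show "(\<alpha> \<union> \<beta>)\<^sup>+ \<subseteq> cjoin F M \<alpha> \<beta>"
  proof
    fix p assume "p \<in> (\<alpha> \<union> \<beta>)\<^sup>+"
    then have "(fst p, snd p) \<in> (\<alpha> \<union> \<beta>)\<^sup>+" by simp
    then have "(fst p, snd p) \<in> cjoin F M \<alpha> \<beta>"
    proof (induction rule: trancl_induct)
      case (base y)
      then show ?case using cjoin_ge by blast
    next
      case (step y z)
      moreover have "(y, z) \<in> cjoin F M \<alpha> \<beta>" using step.hyps(2) cjoin_ge by blast
      ultimately show ?case by (intro Con_trans[OF cjoin_Con[OF assms], of "fst p" y z])
    qed
    then show "p \<in> cjoin F M \<alpha> \<beta>" by simp
  qed
qed

end

section \<open>The term condition, on lists and on valuations\<close>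

lemma centralizesI:
  assumes "\<And>t as bs cs ds. wf_term F t \<Longrightarrow> uvars t \<subseteq> {..<length as + length cs} \<Longrightarrow>
      list_all2 (\<lambda>x y. (x, y) \<in> \<alpha>) as bs \<Longrightarrow> list_all2 (\<lambda>x y. (x, y) \<in> \<beta>) cs ds \<Longrightarrow>
      (term_op M t (as @ cs), term_op M t (as @ ds)) \<in> \<mu> \<longleftrightarrow>
      (term_op M t (bs @ cs), term_op M t (bs @ ds)) \<in> \<mu>"
  shows "centralizes F M \<alpha> \<beta> \<mu>"
  unfolding centralizes_def using assms by (auto simp: list_all2_conv_all_nth)

lemma centralizesD:
  assumes "centralizes F M \<alpha> \<beta> \<mu>" "wf_term F t" "uvars t \<subseteq> {..<length as + length cs}"
    and "list_all2 (\<lambda>x y. (x, y) \<in> \<alpha>) as bs" "list_all2 (\<lambda>x y. (x, y) \<in> \<beta>) cs ds"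
  shows "(term_op M t (as @ cs), term_op M t (as @ ds)) \<in> \<mu> \<longleftrightarrow>
      (term_op M t (bs @ cs), term_op M t (bs @ ds)) \<in> \<mu>"
proof -
  have "length bs = length as" "length ds = length cs"
    "\<forall>i<length as. (as ! i, bs ! i) \<in> \<alpha>" "\<forall>j<length cs. (cs ! j, ds ! j) \<in> \<beta>"
    using assms(4,5) by (auto simp: list_all2_conv_all_nth)
  with assms(1)[unfolded centralizes_def, rule_format, of t "length as" "length cs" as bs cs ds]
    assms(2,3) show ?thesis by blast
qed

lemma centralizes_mono:
  assumes "centralizes F M \<alpha> \<beta> \<mu>" "\<alpha>' \<subseteq> \<alpha>" "\<beta>' \<subseteq> \<beta>"
  shows "centralizes F M \<alpha>' \<beta>' \<mu>"
proof (rule centralizesI)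
  fix t :: "('a, nat) uterm" and as bs cs ds
  assume *: "wf_term F t" "uvars t \<subseteq> {..<length as + length cs}"
    and a: "list_all2 (\<lambda>x y. (x, y) \<in> \<alpha>') as bs" and c: "list_all2 (\<lambda>x y. (x, y) \<in> \<beta>') cs ds"
  show "(term_op M t (as @ cs), term_op M t (as @ ds)) \<in> \<mu> \<longleftrightarrow>
      (term_op M t (bs @ cs), term_op M t (bs @ ds)) \<in> \<mu>"
    using list_all2_mono[OF a, of "\<lambda>x y. (x, y) \<in> \<alpha>"] list_all2_mono[OF c, of "\<lambda>x y. (x, y) \<in> \<beta>"]
      assms(2,3) by (intro centralizesD[OF assms(1) *]) auto
qed

text \<open>The term condition is defined with argument lists and variables in \<open>nat\<close>;
  substitutions are easier to follow with one variable type for each block. A term has finitely many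
  variables, so numbering those of each block, the right ones after the left ones, leads back to
  lists.\<close>

lemma centralizes_valuations:
  fixes t :: "('f, 'p + 'q) uterm"
  assumes "centralizes F M \<alpha> \<beta> \<mu>" "wf_term F t"
    and "\<And>p. (a p, b p) \<in> \<alpha>" "\<And>q. (c q, d q) \<in> \<beta>"
  shows "(eval_term M (case_sum a c) t, eval_term M (case_sum a d) t) \<in> \<mu> \<longleftrightarrow>
    (eval_term M (case_sum b c) t, eval_term M (case_sum b d) t) \<in> \<mu>"
proof -
  obtain ps where ps: "set ps = {p. Inl p \<in> uvars t}"
    using finite_list[of "{p. Inl p \<in> uvars t}"] finite_vimageI[OF finite_uvars, of Inl t]
    by (auto simp: vimage_def)
  obtain qs where qs: "set qs = {q. Inr q \<in> uvars t}"
    using finite_list[of "{q. Inr q \<in> uvars t}"] finite_vimageI[OF finite_uvars, of Inr t]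
    by (auto simp: vimage_def)
  have "\<exists>i. \<forall>p\<in>set ps. i p < length ps \<and> ps ! i p = p"
    by (intro bchoice) (metis in_set_conv_nth)
  then obtain i where i: "\<And>p. p \<in> set ps \<Longrightarrow> i p < length ps \<and> ps ! i p = p" by blast
  have "\<exists>j. \<forall>q\<in>set qs. j q < length qs \<and> qs ! j q = q"
    by (intro bchoice) (metis in_set_conv_nth)
  then obtain j where j: "\<And>q. q \<in> set qs \<Longrightarrow> j q < length qs \<and> qs ! j q = q" by blast
  define \<sigma> where "\<sigma> = case_sum (\<lambda>p. Var (i p)) (\<lambda>q. Var (length ps + j q) :: ('f, nat) uterm)"
  have ev: "term_op M (subst \<sigma> t) (map f ps @ map g qs) = eval_term M (case_sum f g) t" for f g
    unfolding term_op_def eval_subst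
  proof (rule eval_term_cong)
    fix x assume "x \<in> uvars t"
    then show "eval_term M ((!) (map f ps @ map g qs)) (\<sigma> x) = case_sum f g x"
      using i j ps qs by (cases x rule: sum.exhaust) (auto simp: \<sigma>_def nth_append)
  qed
  have "uvars (\<sigma> x) \<subseteq> {..<length ps + length qs}" if "x \<in> uvars t" for x
    using that i j ps qs by (cases x rule: sum.exhaust) (force simp: \<sigma>_def)+
  then have "uvars (subst \<sigma> t) \<subseteq> {..<length (map a ps) + length (map c qs)}"
    unfolding uvars_subst by auto
  moreover have "wf_term F (subst \<sigma> t)"
    using assms(2) by (rule wf_subst) (auto simp: \<sigma>_def split: sum.split)
  ultimately show ?thesis
    using centralizesD[OF assms(1), of "subst \<sigma> t" "map a ps" "map c qs" "map b ps" "map d qs"]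
      assms(3,4) by (simp add: ev list.rel_map list.rel_refl_strong)
qed

text \<open>Valuations are total while argument lists are finite; \<open>z\<close> fills the
  remaining positions, where the two valuations must still be related.\<close>

lemma centralizesI_valuations:
  assumes ne: "(z, z) \<in> \<alpha>" "(z, z) \<in> \<beta>"
    and *: "\<And>(t :: ('f, nat + nat) uterm) a b c d. wf_term F t \<Longrightarrow>
      (\<And>i. (a i, b i) \<in> \<alpha>) \<Longrightarrow> (\<And>j. (c j, d j) \<in> \<beta>) \<Longrightarrow>
      (eval_term M (case_sum a c) t, eval_term M (case_sum a d) t) \<in> \<mu> \<longleftrightarrow>
      (eval_term M (case_sum b c) t, eval_term M (case_sum b d) t) \<in> \<mu>"
  shows "centralizes F M \<alpha> \<beta> \<mu>"
proof (rule centralizesI)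
  fix t :: "('f, nat) uterm" and as bs cs ds
  assume t: "wf_term F t" "uvars t \<subseteq> {..<length as + length cs}"
    and l: "list_all2 (\<lambda>x y. (x, y) \<in> \<alpha>) as bs" "list_all2 (\<lambda>x y. (x, y) \<in> \<beta>) cs ds"
  define \<sigma> where "\<sigma> k = (Var (if k < length as then Inl k else Inr (k - length as)) :: ('f, nat + nat) uterm)" for k
  define pad where "pad xs k = (if k < length xs then xs ! k else z)" for xs k
  have ev: "eval_term M (case_sum (pad us) (pad vs)) (subst \<sigma> t) = term_op M t (us @ vs)"
    if "length us = length as" "length vs = length cs" for us vs
    unfolding term_op_def eval_subst
    by (rule eval_term_cong) (use that t(2) in \<open>auto simp: \<sigma>_def pad_def nth_append\<close>)
  have "wf_term F (subst \<sigma> t)"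
    using t(1) by (rule wf_subst) (simp add: \<sigma>_def)
  moreover have "(pad as i, pad bs i) \<in> \<alpha>" "(pad cs i, pad ds i) \<in> \<beta>" for i
    using l ne by (auto simp: pad_def list_all2_conv_all_nth)
  ultimately show "(term_op M t (as @ cs), term_op M t (as @ ds)) \<in> \<mu> \<longleftrightarrow>
      (term_op M t (bs @ cs), term_op M t (bs @ ds)) \<in> \<mu>"
    using *[of "subst \<sigma> t" "pad as" "pad bs" "pad cs" "pad ds"] l[THEN list_all2_lengthD]
    by (simp add: ev)
qed

lemma term_op_Con:
  assumes "\<theta> \<in> Con F M" "wf_term F t" "uvars t \<subseteq> {..<length xs}" "list_all2 (\<lambda>x y. (x, y) \<in> \<theta>) xs ys"
  shows "(term_op M t xs, term_op M t ys) \<in> \<theta>"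
  unfolding term_op_def using assms(3,4)
  by (intro Con_eval_term[OF assms(1,2)]) (auto simp: list_all2_conv_all_nth)

context univ_algebra
begin

text \<open>Replacing the left arguments moves each entry of the pair only inside \<mu>, so
  membership of the pair in \<mu> cannot change.\<close>

lemma centralizes_self_left:
  assumes "\<mu> \<in> Con F M" "\<beta> \<in> Con F M"
  shows "centralizes F M \<mu> \<beta> \<mu>"
proof (rule centralizesI)
  fix t :: "('f, nat) uterm" and as bs cs ds
  assume t: "wf_term F t" "uvars t \<subseteq> {..<length as + length cs}"
    and a: "list_all2 (\<lambda>x y. (x, y) \<in> \<mu>) as bs" and c: "list_all2 (\<lambda>x y. (x, y) \<in> \<beta>) cs ds"
  have C: "set cs \<subseteq> carrier M" "set ds \<subseteq> carrier M"
    using c by (induction rule: list_all2_induct) (auto dest: Con_carrier[OF assms(2)])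
  have "(term_op M t (as @ vs), term_op M t (bs @ vs)) \<in> \<mu>"
    if "set vs \<subseteq> carrier M" "length vs = length cs" for vs
    using that a t
    by (intro term_op_Con[OF assms(1)]) (auto intro!: list_all2_appendI Con_list_refl[OF assms(1)])
  from this[OF C(1)] this[OF C(2)] list_all2_lengthD[OF c]
  show "(term_op M t (as @ cs), term_op M t (as @ ds)) \<in> \<mu> \<longleftrightarrow>
      (term_op M t (bs @ cs), term_op M t (bs @ ds)) \<in> \<mu>"
    using Con_sym[OF assms(1)] Con_trans[OF assms(1)] by metis
qed

text \<open>Here both sides of the equivalence are true, because the right arguments differ only by
  \<mu>.\<close>

lemma centralizes_self_right:
  assumes "\<alpha> \<in> Con F M" "\<mu> \<in> Con F M"
  shows "centralizes F M \<alpha> \<mu> \<mu>"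
proof (rule centralizesI)
  fix t :: "('f, nat) uterm" and as bs cs ds
  assume t: "wf_term F t" "uvars t \<subseteq> {..<length as + length cs}"
    and a: "list_all2 (\<lambda>x y. (x, y) \<in> \<alpha>) as bs" and c: "list_all2 (\<lambda>x y. (x, y) \<in> \<mu>) cs ds"
  have C: "set as \<subseteq> carrier M" "set bs \<subseteq> carrier M"
    using a by (induction rule: list_all2_induct) (auto dest: Con_carrier[OF assms(1)])
  have "(term_op M t (us @ cs), term_op M t (us @ ds)) \<in> \<mu>"
    if "set us \<subseteq> carrier M" "length us = length as" for us
    using that c t
    by (intro term_op_Con[OF assms(2)]) (auto intro!: list_all2_appendI Con_list_refl[OF assms(2)])
  from this[OF C(1)] this[OF C(2)] list_all2_lengthD[OF a]
  show "(term_op M t (as @ cs), term_op M t (as @ ds)) \<in> \<mu> \<longleftrightarrow>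
      (term_op M t (bs @ cs), term_op M t (bs @ ds)) \<in> \<mu>"
    by simp
qed

text \<open>The truth value \<open>P\<close> is unchanged by every single step of a chain that
  witnesses the join, whichever of the two congruences it uses; hence
  \<open>list_all2_trancl_steps\<close> is applied with the relation \<open>Id\<close> on truth
  values.\<close>

lemma centralizes_cjoin_left:
  assumes "\<alpha>\<^sub>1 \<in> Con F M" "\<alpha>\<^sub>2 \<in> Con F M" "\<beta> \<in> Con F M"
    and "centralizes F M \<alpha>\<^sub>1 \<beta> \<mu>" "centralizes F M \<alpha>\<^sub>2 \<beta> \<mu>"
  shows "centralizes F M (cjoin F M \<alpha>\<^sub>1 \<alpha>\<^sub>2) \<beta> \<mu>"
proof (rule centralizesI)
  fix t :: "('f, nat) uterm" and as bs cs ds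
  assume t: "wf_term F t" "uvars t \<subseteq> {..<length as + length cs}"
    and a: "list_all2 (\<lambda>x y. (x, y) \<in> cjoin F M \<alpha>\<^sub>1 \<alpha>\<^sub>2) as bs"
    and c: "list_all2 (\<lambda>x y. (x, y) \<in> \<beta>) cs ds"
  define P where "P us \<longleftrightarrow> (term_op M t (us @ cs), term_op M t (us @ ds)) \<in> \<mu>" for us
  have "(P as, P bs) \<in> Id"
  proof (rule list_all2_trancl_steps)
    show "list_all2 (\<lambda>x y. (x, y) \<in> (\<alpha>\<^sub>1 \<union> \<alpha>\<^sub>2)\<^sup>+) as bs"
      using a unfolding cjoin_eq_trancl[OF assms(1,2)] .
    show "\<alpha>\<^sub>1 \<union> \<alpha>\<^sub>2 \<subseteq> nabla M" using assms(1,2) Con_subset by blast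
    show "set as \<subseteq> carrier M"
      using a by (induction rule: list_all2_induct)
        (auto dest: Con_carrier[OF cjoin_Con[OF assms(1,2)]])
    fix pre x y suf
    assume xy: "(x, y) \<in> \<alpha>\<^sub>1 \<union> \<alpha>\<^sub>2" and C: "set pre \<subseteq> carrier M" "set suf \<subseteq> carrier M"
      and len: "length (pre @ x # suf) = length as"
    have "P (pre @ x # suf) = P (pre @ y # suf)"
      if "(x, y) \<in> \<alpha>" "\<alpha> \<in> Con F M" "centralizes F M \<alpha> \<beta> \<mu>" for \<alpha>
      unfolding P_def using that C t len
      by (intro centralizesD[OF that(3) t(1) _ _ c] list_all2_appendI list.rel_intros
          Con_list_refl[OF that(2)]) auto
    with xy assms show "(P (pre @ x # suf), P (pre @ y # suf)) \<in> Id" by auto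
  qed (auto simp: trans_Id)
  then show "(term_op M t (as @ cs), term_op M t (as @ ds)) \<in> \<mu> \<longleftrightarrow>
      (term_op M t (bs @ cs), term_op M t (bs @ ds)) \<in> \<mu>"
    by (simp add: P_def)
qed

text \<open>\<open>Inter_Con\<close> needs a nonempty family; \<alpha> itself is a member, by
  \<open>centralizes_self_left\<close>.\<close>

lemma commutator_Con:
  assumes "\<alpha> \<in> Con F M" "\<beta> \<in> Con F M"
  shows "commutator F M \<alpha> \<beta> \<in> Con F M"
  unfolding commutator_def
  by (rule Inter_Con) (use assms centralizes_self_left[OF assms] in auto)

lemma commutator_subset:
  assumes "\<alpha> \<in> Con F M" "\<beta> \<in> Con F M"
  shows "commutator F M \<alpha> \<beta> \<subseteq> \<alpha> \<inter> \<beta>"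
  unfolding commutator_def using assms centralizes_self_left centralizes_self_right by blast

lemma commutator_mono:
  assumes "\<alpha>' \<subseteq> \<alpha>" "\<beta>' \<subseteq> \<beta>"
  shows "commutator F M \<alpha>' \<beta>' \<subseteq> commutator F M \<alpha> \<beta>"
  unfolding commutator_def using centralizes_mono[OF _ assms] by blast

lemma commutator_least:
  "\<mu> \<in> Con F M \<Longrightarrow> centralizes F M \<alpha> \<beta> \<mu> \<Longrightarrow> commutator F M \<alpha> \<beta> \<subseteq> \<mu>"
  unfolding commutator_def by blast

end

lemma varietyI:
  assumes "is_algebra F M"
    and "\<And>s t v. (s, t) \<in> E \<Longrightarrow> range v \<subseteq> carrier M \<Longrightarrow> eval_term M v s = eval_term M v t"
  shows "M \<in> variety F E"
  unfolding variety_def using assms by blast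

section \<open>Surjective homomorphisms\<close>

text \<open>One setting for three maps: the projection of an algebra onto a quotient, that of the
  term algebra onto the relatively free algebra, and the bijection of \<open>A\<close> onto a copy
  in another type.\<close>

locale surj_hom = dom: univ_algebra F M
  for F :: "('f \<times> nat) set" and M :: "('f, 'a) algebra" +
  fixes N :: "('f, 'b) algebra" and h :: "'a \<Rightarrow> 'b"
  assumes onto: "h ` carrier M = carrier N"
    and hom_interp: "(f, length xs) \<in> F \<Longrightarrow> set xs \<subseteq> carrier M \<Longrightarrow>
      h (interp M f xs) = interp N f (map h xs)"
begin

lemma h_closed: "x \<in> carrier M \<Longrightarrow> h x \<in> carrier N"
  using onto by blast

lemma lift_list: "set ys \<subseteq> carrier N \<Longrightarrow> \<exists>xs. set xs \<subseteq> carrier M \<and> ys = map h xs"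
  unfolding onto[symmetric]
proof (induction ys)
  case (Cons y ys)
  then obtain x xs where "x \<in> carrier M" "y = h x" "set xs \<subseteq> carrier M" "ys = map h xs"
    by auto
  then show ?case by (intro exI[of _ "x # xs"]) auto
qed simp

sublocale cod: univ_algebra F N
proof
  have closed: "interp M f xs \<in> carrier M" if "(f, length xs) \<in> F" "set xs \<subseteq> carrier M" for f xs
    using dom.is_algebra that unfolding is_algebra_def closed_under_def by blast
  have "interp N f ys \<in> carrier N" if f: "(f, length ys) \<in> F" and ys: "set ys \<subseteq> carrier N" for f ys
  proof -
    obtain xs where "set xs \<subseteq> carrier M" "ys = map h xs" using lift_list[OF ys] by blast
    with f show ?thesis using hom_interp[of f xs] h_closed[OF closed[of f xs]] by simp
  qed
  moreover have "carrier N \<noteq> {}"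
    using dom.is_algebra onto unfolding is_algebra_def by blast
  ultimately show "is_algebra F N"
    unfolding is_algebra_def closed_under_def by blast
qed

lemma hom_eval_term:
  "wf_term F t \<Longrightarrow> (\<And>x. x \<in> uvars t \<Longrightarrow> v x \<in> carrier M) \<Longrightarrow>
    h (eval_term M v t) = eval_term N (\<lambda>x. h (v x)) t"
proof (induction t)
  case (Op f ts)
  have "set (map (eval_term M v) ts) \<subseteq> carrier M"
    using Op.prems by (auto intro!: eval_term_closed[OF dom.is_algebra])
  moreover have "map h (map (eval_term M v) ts) = map (eval_term N (\<lambda>x. h (v x))) ts"
    unfolding map_map using Op by (intro map_cong) auto
  ultimately show ?case
    using Op.prems hom_interp[of f "map (eval_term M v) ts"] by (simp del: map_map map_eq_conv)
qed simp

lemma hom_term_op: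
  assumes "wf_term F t" "uvars t \<subseteq> {..<length xs}" "set xs \<subseteq> carrier M"
  shows "h (term_op M t xs) = term_op N t (map h xs)" "term_op M t xs \<in> carrier M"
proof -
  have xs: "xs ! i \<in> carrier M" if "i \<in> uvars t" for i using that assms(2,3) by (auto dest: nth_mem)
  show "term_op M t xs \<in> carrier M"
    unfolding term_op_def using xs by (rule eval_term_closed[OF dom.is_algebra assms(1)])
  have "h (term_op M t xs) = eval_term N (\<lambda>i. h (xs ! i)) t"
    unfolding term_op_def using xs by (rule hom_eval_term[OF assms(1)])
  also have "\<dots> = term_op N t (map h xs)"
    unfolding term_op_def by (rule eval_term_cong) (use assms(2) in auto)
  finally show "h (term_op M t xs) = term_op N t (map h xs)" .
qed

section \<open>Congruences along a surjective homomorphism\<close>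

definition pull :: "'b rel \<Rightarrow> 'a rel" where
  "pull \<mu> = {(x, y). x \<in> carrier M \<and> y \<in> carrier M \<and> (h x, h y) \<in> \<mu>}"

definition push :: "'a rel \<Rightarrow> 'b rel" where
  "push \<alpha> = map_prod h h ` \<alpha>"

definition ker :: "'a rel" where
  "ker = {(x, y). x \<in> carrier M \<and> y \<in> carrier M \<and> h x = h y}"

lemma pull_mono: "\<mu> \<subseteq> \<nu> \<Longrightarrow> pull \<mu> \<subseteq> pull \<nu>"
  unfolding pull_def by auto

lemma pull_nabla: "pull \<mu> \<subseteq> nabla M"
  unfolding pull_def by auto

lemma push_nabla: "\<alpha> \<subseteq> nabla M \<Longrightarrow> push \<alpha> \<subseteq> nabla N"
  unfolding push_def using h_closed by auto

lemma lift_list_all2: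
  assumes "list_all2 (\<lambda>x y. (x, y) \<in> push \<alpha>) xs ys" "\<alpha> \<subseteq> nabla M"
  obtains us vs where "xs = map h us" "ys = map h vs" "list_all2 (\<lambda>x y. (x, y) \<in> \<alpha>) us vs"
    "set us \<subseteq> carrier M" "set vs \<subseteq> carrier M" "length vs = length us"
proof -
  have "\<exists>us vs. xs = map h us \<and> ys = map h vs \<and> list_all2 (\<lambda>x y. (x, y) \<in> \<alpha>) us vs"
    using assms(1)
  proof (induction rule: list_all2_induct)
    case (Cons x xs y ys)
    then obtain u v us vs where "(u, v) \<in> \<alpha>" "x = h u" "y = h v" "xs = map h us" "ys = map h vs"
      "list_all2 (\<lambda>x y. (x, y) \<in> \<alpha>) us vs"
      unfolding push_def by auto
    then show ?case by (intro exI[of _ "u # us"] exI[of _ "v # vs"]) auto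
  qed simp
  then obtain us vs where *: "xs = map h us" "ys = map h vs" "list_all2 (\<lambda>x y. (x, y) \<in> \<alpha>) us vs"
    by blast
  have "set us \<subseteq> carrier M \<and> set vs \<subseteq> carrier M"
    using *(3) assms(2) by (induction rule: list_all2_induct) auto
  with * list_all2_lengthD[OF *(3)] show thesis by (intro that[of us vs]) auto
qed

lemma pull_Con:
  assumes "\<mu> \<in> Con F N"
  shows "pull \<mu> \<in> Con F M"
proof (rule ConI)
  show "(interp M f xs, interp M f ys) \<in> pull \<mu>"
    if "(f, length xs) \<in> F" and l: "list_all2 (\<lambda>x y. (x, y) \<in> pull \<mu>) xs ys" for f xs ys
  proof -
    have C: "set xs \<subseteq> carrier M" "set ys \<subseteq> carrier M" "length ys = length xs"
      using l by (induction rule: list_all2_induct) (auto simp: pull_def)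
    have "list_all2 (\<lambda>x y. (x, y) \<in> \<mu>) (map h xs) (map h ys)"
      unfolding list.rel_map using l by (rule list_all2_mono) (simp add: pull_def)
    then show ?thesis
      using that(1) C hom_interp[of f] Con_interp[OF assms, of f "map h xs" "map h ys"] dom.is_algebra
      unfolding is_algebra_def closed_under_def by (simp add: pull_def)
  qed
  show "(x, z) \<in> pull \<mu>" if "(x, y) \<in> pull \<mu>" "(y, z) \<in> pull \<mu>" for x y z
    using that Con_trans[OF assms] unfolding pull_def by blast
qed (use h_closed in \<open>auto simp: pull_def intro: Con_refl[OF assms] Con_sym[OF assms]\<close>)

lemma ker_subset_pull: "\<mu> \<in> Con F N \<Longrightarrow> ker \<subseteq> pull \<mu>"
  unfolding pull_def ker_def using h_closed by (auto intro!: Con_refl)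

lemma subset_pull_push: "\<alpha> \<subseteq> nabla M \<Longrightarrow> \<alpha> \<subseteq> pull (push \<alpha>)"
  unfolding pull_def push_def by (auto intro!: rev_image_eqI)

text \<open>Since \<alpha> contains the kernel, points with the same images as a pair in \<alpha>
  are linked to that pair by kernel steps. With \<open>push_pull\<close> this is the correspondence
  theorem: congruences of \<open>N\<close> are congruences of \<open>M\<close> above
  \<open>ker\<close>.\<close>

lemma pull_push:
  assumes "\<alpha> \<in> Con F M" "ker \<subseteq> \<alpha>"
  shows "pull (push \<alpha>) = \<alpha>"
proof
  show "pull (push \<alpha>) \<subseteq> \<alpha>"
  proof
    fix p assume "p \<in> pull (push \<alpha>)"
    then obtain x y x' y' where *: "p = (x, y)" "x \<in> carrier M" "y \<in> carrier M"
        "h x = h x'" "h y = h y'" "(x', y') \<in> \<alpha>"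
      unfolding pull_def push_def by auto
    then have "(x, x') \<in> \<alpha>" "(y', y) \<in> \<alpha>"
      using assms(2) Con_carrier[OF assms(1)] unfolding ker_def by auto
    with * show "p \<in> \<alpha>" using Con_trans[OF assms(1)] by blast
  qed
  show "\<alpha> \<subseteq> pull (push \<alpha>)"
    using Con_subset[OF assms(1)] by (rule subset_pull_push)
qed

lemma push_pull: "\<mu> \<subseteq> nabla N \<Longrightarrow> push (pull \<mu>) = \<mu>"
  unfolding onto[symmetric] by (force simp: pull_def push_def)

lemma pull_subset_iff: "\<mu> \<in> Con F N \<Longrightarrow> pull \<mu> \<subseteq> pull \<nu> \<longleftrightarrow> \<mu> \<subseteq> \<nu>"
proof
  assume "\<mu> \<in> Con F N" and le: "pull \<mu> \<subseteq> pull \<nu>"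
  then have "\<mu> = push (pull \<mu>)" using push_pull Con_subset by metis
  also have "\<dots> \<subseteq> push (pull \<nu>)" using le unfolding push_def by blast
  also have "\<dots> \<subseteq> \<nu>" unfolding push_def pull_def by auto
  finally show "\<mu> \<subseteq> \<nu>" .
qed (rule pull_mono)

lemma push_Con:
  assumes \<alpha>: "\<alpha> \<in> Con F M" and "ker \<subseteq> \<alpha>"
  shows "push \<alpha> \<in> Con F N"
proof (rule ConI)
  have iff: "(h x, h y) \<in> push \<alpha> \<longleftrightarrow> (x, y) \<in> \<alpha>" if "x \<in> carrier M" "y \<in> carrier M" for x y
    using pull_push[OF assms] that unfolding pull_def by blast
  show sub: "push \<alpha> \<subseteq> nabla N" using push_nabla[OF Con_subset[OF \<alpha>]] .
  show "(x, x) \<in> push \<alpha>" if "x \<in> carrier N" for x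
    using that unfolding onto[symmetric] by (auto simp: iff Con_refl[OF \<alpha>])
  show "(y, x) \<in> push \<alpha>" if "(x, y) \<in> push \<alpha>" for x y
    using that Con_sym[OF \<alpha>] unfolding push_def by force
  \<comment> \<open>The two pairs may arise from different preimages of \<open>y\<close>; by
    \<open>iff\<close>, membership can be tested on one common preimage.\<close>
  show "(x, z) \<in> push \<alpha>" if xyz: "(x, y) \<in> push \<alpha>" "(y, z) \<in> push \<alpha>" for x y z
  proof -
    have "x \<in> h ` carrier M" "y \<in> h ` carrier M" "z \<in> h ` carrier M"
      using sub xyz unfolding onto by auto
    then obtain x' y' z' where *: "x = h x'" "y = h y'" "z = h z'"
      "x' \<in> carrier M" "y' \<in> carrier M" "z' \<in> carrier M"
      by blast
    then show ?thesis using xyz Con_trans[OF \<alpha>, of x' y' z'] by (simp add: iff)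
  qed
  show "(interp N f xs, interp N f ys) \<in> push \<alpha>"
    if f: "(f, length xs) \<in> F" and l: "list_all2 (\<lambda>x y. (x, y) \<in> push \<alpha>) xs ys" for f xs ys
  proof -
    obtain us vs where *: "xs = map h us" "ys = map h vs" "list_all2 (\<lambda>x y. (x, y) \<in> \<alpha>) us vs"
      and C: "set us \<subseteq> carrier M" "set vs \<subseteq> carrier M"
      using lift_list_all2[OF l Con_subset[OF \<alpha>]] .
    have "(interp M f us, interp M f vs) \<in> \<alpha>"
      using Con_interp[OF \<alpha> _ *(3)] f * by simp
    then have "(h (interp M f us), h (interp M f vs)) \<in> push \<alpha>"
      unfolding push_def by force
    then show ?thesis
      using hom_interp[of f us] hom_interp[of f vs] f * C list_all2_lengthD[OF *(3)] by simp
  qed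
qed

text \<open>Generating in \<open>N\<close> corresponds to generating in \<open>M\<close> once the
  kernel joins the generators. Joins and finitely generated congruences are transported through
  this.\<close>

lemma pull_Cg:
  assumes "X \<subseteq> nabla M"
  shows "pull (Cg F N (push X)) = Cg F M (X \<union> ker)"
proof
  let ?\<gamma> = "Cg F M (X \<union> ker)"
  have C: "X \<union> ker \<subseteq> nabla M" using assms unfolding ker_def by auto
  have \<gamma>: "?\<gamma> \<in> Con F M" "X \<subseteq> ?\<gamma>" "ker \<subseteq> ?\<gamma>"
    using dom.Cg_Con[OF C] dom.Cg_superset[of "X \<union> ker"] by auto
  have "push X \<subseteq> push ?\<gamma>" using \<gamma> unfolding push_def by blast
  then have "pull (Cg F N (push X)) \<subseteq> pull (push ?\<gamma>)"
    by (intro pull_mono cod.Cg_least push_Con \<gamma>)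
  then show "pull (Cg F N (push X)) \<subseteq> ?\<gamma>" using pull_push \<gamma> by simp
  have N: "Cg F N (push X) \<in> Con F N" using push_nabla[OF assms] by (rule cod.Cg_Con)
  have "X \<subseteq> pull (Cg F N (push X))"
    using subset_pull_push[OF assms] pull_mono[OF cod.Cg_superset] by blast
  then show "?\<gamma> \<subseteq> pull (Cg F N (push X))"
    using ker_subset_pull[OF N] by (intro dom.Cg_least pull_Con N) auto
qed

lemma pull_cjoin:
  assumes "\<mu> \<in> Con F N" "\<nu> \<in> Con F N"
  shows "pull (cjoin F N \<mu> \<nu>) = cjoin F M (pull \<mu>) (pull \<nu>)"
proof -
  have "push (pull \<mu> \<union> pull \<nu>) = \<mu> \<union> \<nu>"
    using push_pull assms[THEN Con_subset] unfolding push_def by (simp add: image_Un)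
  then have "pull (cjoin F N \<mu> \<nu>) = Cg F M (pull \<mu> \<union> pull \<nu> \<union> ker)"
    unfolding cjoin_def using pull_Cg[of "pull \<mu> \<union> pull \<nu>"] pull_nabla by simp
  then show ?thesis
    unfolding cjoin_def using ker_subset_pull[OF assms(1)] by (simp add: Un_absorb2 le_supI1)
qed

lemma Cg_Un_ker:
  assumes "X \<subseteq> nabla M"
  shows "Cg F M (X \<union> ker) = cjoin F M (Cg F M X) ker"
proof
  have C: "X \<union> ker \<subseteq> nabla M" "Cg F M X \<union> ker \<subseteq> nabla M"
    using assms Con_subset[OF dom.Cg_Con[OF assms]] unfolding ker_def by auto
  show "Cg F M (X \<union> ker) \<subseteq> cjoin F M (Cg F M X) ker"
    unfolding cjoin_def using dom.Cg_superset
    by (intro dom.Cg_least dom.Cg_Con C) blast+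
  show "cjoin F M (Cg F M X) ker \<subseteq> Cg F M (X \<union> ker)"
    unfolding cjoin_def using dom.Cg_superset[of "X \<union> ker"]
    by (simp add: dom.Cg_subset_iff[OF dom.Cg_Con[OF C(1)]])
qed

text \<open>Together with \<open>fg_con_pull\<close>: up to \<open>pull\<close>, the compact
  congruences of \<open>N\<close> are the joins of \<open>ker\<close> with compact congruences of
  \<open>M\<close>, even if \<open>ker\<close> is not compact. This parametrizes the reticulation of
  a quotient by compact congruences of the original algebra.\<close>

lemma fg_con_push: "\<alpha> \<in> fg_con F M \<Longrightarrow> \<exists>\<nu>\<in>fg_con F N. pull \<nu> = cjoin F M \<alpha> ker"
proof -
  assume "\<alpha> \<in> fg_con F M"
  then obtain X where "finite X" "X \<subseteq> nabla M" "\<alpha> = Cg F M X" unfolding fg_con_def by auto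
  then show ?thesis
    using pull_Cg[of X] Cg_Un_ker[of X] push_nabla[of X] unfolding fg_con_def
    by (intro bexI[of _ "Cg F N (push X)"]) (auto simp: push_def)
qed

lemma fg_con_pull:
  assumes "\<nu> \<in> fg_con F N"
  shows "\<exists>\<alpha>\<in>fg_con F M. pull \<nu> = cjoin F M \<alpha> ker"
proof -
  obtain Y where Y: "finite Y" "Y \<subseteq> nabla N" "\<nu> = Cg F N Y" using assms unfolding fg_con_def by auto
  have "Y \<subseteq> map_prod h h ` nabla M" using Y(2) unfolding onto[symmetric] by force
  then obtain X where X: "X \<subseteq> nabla M" "finite X" "Y = push X"
    using finite_subset_image[OF Y(1)] unfolding push_def by metis
  then show ?thesis
    using pull_Cg[of X] Cg_Un_ker[of X] Y(3) unfolding fg_con_def by blast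
qed

section \<open>The commutator along a surjective homomorphism\<close>

lemma centralizes_pull:
  assumes "centralizes F N \<mu> \<nu> \<kappa>"
  shows "centralizes F M (pull \<mu>) (pull \<nu>) (pull \<kappa>)"
proof (rule centralizesI)
  fix t :: "('f, nat) uterm" and as bs cs ds
  assume t: "wf_term F t" "uvars t \<subseteq> {..<length as + length cs}"
    and a: "list_all2 (\<lambda>x y. (x, y) \<in> pull \<mu>) as bs" and c: "list_all2 (\<lambda>x y. (x, y) \<in> pull \<nu>) cs ds"
  have C: "set as \<subseteq> carrier M" "set bs \<subseteq> carrier M" "length bs = length as"
    using a by (induction rule: list_all2_induct) (auto simp: pull_def)
  have D: "set cs \<subseteq> carrier M" "set ds \<subseteq> carrier M" "length ds = length cs"
    using c by (induction rule: list_all2_induct) (auto simp: pull_def)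
  have a': "list_all2 (\<lambda>x y. (x, y) \<in> \<mu>) (map h as) (map h bs)"
    unfolding list.rel_map using a by (rule list_all2_mono) (simp add: pull_def)
  have c': "list_all2 (\<lambda>x y. (x, y) \<in> \<nu>) (map h cs) (map h ds)"
    unfolding list.rel_map using c by (rule list_all2_mono) (simp add: pull_def)
  show "(term_op M t (as @ cs), term_op M t (as @ ds)) \<in> pull \<kappa> \<longleftrightarrow>
      (term_op M t (bs @ cs), term_op M t (bs @ ds)) \<in> pull \<kappa>"
    using centralizesD[OF assms t(1) _ a' c'] t C D by (simp add: pull_def hom_term_op)
qed

text \<open>Related lists in \<open>N\<close> lift pair by pair to related lists in
  \<open>M\<close>, and \<open>h\<close> commutes with term operations, so every instance in
  \<open>N\<close> is the image of an instance in \<open>M\<close>.\<close>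

lemma centralizes_push:
  assumes "centralizes F M \<alpha> \<beta> (pull \<mu>)" "\<alpha> \<subseteq> nabla M" "\<beta> \<subseteq> nabla M"
  shows "centralizes F N (push \<alpha>) (push \<beta>) \<mu>"
proof (rule centralizesI)
  fix t :: "('f, nat) uterm" and as bs cs ds
  assume t: "wf_term F t" "uvars t \<subseteq> {..<length as + length cs}"
    and a: "list_all2 (\<lambda>x y. (x, y) \<in> push \<alpha>) as bs" and c: "list_all2 (\<lambda>x y. (x, y) \<in> push \<beta>) cs ds"
  obtain as' bs' where a': "as = map h as'" "bs = map h bs'" "list_all2 (\<lambda>x y. (x, y) \<in> \<alpha>) as' bs'"
    "set as' \<subseteq> carrier M" "set bs' \<subseteq> carrier M" "length bs' = length as'"
    using lift_list_all2[OF a assms(2)] .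
  obtain cs' ds' where c': "cs = map h cs'" "ds = map h ds'" "list_all2 (\<lambda>x y. (x, y) \<in> \<beta>) cs' ds'"
    "set cs' \<subseteq> carrier M" "set ds' \<subseteq> carrier M" "length ds' = length cs'"
    using lift_list_all2[OF c assms(3)] .
  have u: "uvars t \<subseteq> {..<length as' + length cs'}" using t(2) a' c' by simp
  have "(term_op M t (us @ vs), term_op M t (us @ ws)) \<in> pull \<mu> \<longleftrightarrow>
      (term_op N t (map h us @ map h vs), term_op N t (map h us @ map h ws)) \<in> \<mu>"
    if "set us \<subseteq> carrier M" "set vs \<subseteq> carrier M" "set ws \<subseteq> carrier M"
      "length us = length as'" "length vs = length cs'" "length ws = length cs'" for us vs ws
    using that u hom_term_op[OF t(1), of "us @ vs"] hom_term_op[OF t(1), of "us @ ws"]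
    by (simp add: pull_def)
  then show "(term_op N t (as @ cs), term_op N t (as @ ds)) \<in> \<mu> \<longleftrightarrow>
      (term_op N t (bs @ cs), term_op N t (bs @ ds)) \<in> \<mu>"
    using centralizesD[OF assms(1) t(1) u a'(3) c'(3)] a' c' by simp
qed

lemma commutator_pull_subset:
  assumes "\<mu> \<in> Con F N" "\<nu> \<in> Con F N"
  shows "commutator F M (pull \<mu>) (pull \<nu>) \<subseteq> pull (commutator F N \<mu> \<nu>)"
proof
  fix p assume p: "p \<in> commutator F M (pull \<mu>) (pull \<nu>)"
  have "p \<in> pull \<kappa>" if "\<kappa> \<in> Con F N" "centralizes F N \<mu> \<nu> \<kappa>" for \<kappa>
    using p dom.commutator_least[OF pull_Con[OF that(1)] centralizes_pull[OF that(2)]] by blast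
  \<comment> \<open>This supplies that the components of \<open>p\<close> lie in the carrier, as
    \<open>pull\<close> demands.\<close>
  moreover have "p \<in> pull \<mu>"
    using p dom.commutator_subset[OF assms[THEN pull_Con]] by blast
  ultimately show "p \<in> pull (commutator F N \<mu> \<nu>)"
    unfolding commutator_def pull_def by auto
qed

text \<open>For a map injective on the carrier every congruence contains the kernel, so the term
  condition travels in both directions.\<close>

lemma commutator_push:
  assumes "ker \<subseteq> Id" "\<alpha> \<in> Con F M" "\<beta> \<in> Con F M"
  shows "pull (commutator F N (push \<alpha>) (push \<beta>)) = commutator F M \<alpha> \<beta>"
proof
  have ker: "ker \<subseteq> \<gamma>" if "\<gamma> \<in> Con F M" for \<gamma>
    using assms(1) Con_refl[OF that] unfolding ker_def by auto
  show "commutator F M \<alpha> \<beta> \<subseteq> pull (commutator F N (push \<alpha>) (push \<beta>))"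
    using commutator_pull_subset[of "push \<alpha>" "push \<beta>"] assms ker by (simp add: push_Con pull_push)
  have "pull (commutator F N (push \<alpha>) (push \<beta>)) \<subseteq> \<mu>"
    if "\<mu> \<in> Con F M" "centralizes F M \<alpha> \<beta> \<mu>" for \<mu>
  proof -
    have "centralizes F N (push \<alpha>) (push \<beta>) (push \<mu>)"
      using that assms ker by (intro centralizes_push) (simp_all add: pull_push Con_subset)
    then have "commutator F N (push \<alpha>) (push \<beta>) \<subseteq> push \<mu>"
      using that ker by (intro cod.commutator_least push_Con)
    then show ?thesis using pull_mono[of _ "push \<mu>"] pull_push[OF that(1) ker[OF that(1)]] by metis
  qed
  then show "pull (commutator F N (push \<alpha>) (push \<beta>)) \<subseteq> commutator F M \<alpha> \<beta>"
    unfolding commutator_def by auto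
qed

lemma variety_image:
  assumes "M \<in> variety F E" "wf_identities F E"
  shows "N \<in> variety F E"
proof (rule varietyI[OF cod.is_algebra])
  fix s t :: "('f, nat) uterm" and v :: "nat \<Rightarrow> 'b"
  assume st: "(s, t) \<in> E" and v: "range v \<subseteq> carrier N"
  have wf: "wf_term F s" "wf_term F t" using assms(2) st unfolding wf_identities_def by auto
  have "\<forall>i. \<exists>x. x \<in> carrier M \<and> v i = h x" using v unfolding onto[symmetric] by blast
  then obtain w :: "nat \<Rightarrow> 'a" where w: "\<And>i. w i \<in> carrier M" "\<And>i. v i = h (w i)" by metis
  then have v_eq: "v = (\<lambda>i. h (w i))" by blast
  have "eval_term M w s = eval_term M w t"
    using w(1) assms(1) st unfolding variety_def by blast
  then show "eval_term N v s = eval_term N v t"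
    using hom_eval_term[OF wf(1), of w] hom_eval_term[OF wf(2), of w] w(1) by (simp add: v_eq)
qed

end

text \<open>An operation of the quotient is a union over all lists of representatives. Compatibility
  of \<theta> gives the same class for each list, and reflexivity provides at least one list, so the
  union is taken over a singleton.\<close>

lemma quotient_surj_hom:
  assumes "is_algebra F M" "\<theta> \<in> Con F M"
  shows "surj_hom F M (quotient_algebra M \<theta>) (\<lambda>x. \<theta> `` {x})"
proof (unfold_locales)
  note eq = Con_equiv[OF assms(2)]
  show "is_algebra F M" by fact
  show "(\<lambda>x. \<theta> `` {x}) ` carrier M = carrier (quotient_algebra M \<theta>)"
    by (auto simp: quotient_algebra_def quotient_def)
  fix f xs assume f: "(f, length xs) \<in> F" and xs: "set xs \<subseteq> carrier M"
  have 1: "\<theta> `` {interp M f ys} = \<theta> `` {interp M f xs}"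
    if "list_all2 (\<in>) ys (map (\<lambda>x. \<theta> `` {x}) xs)" for ys
  proof -
    have "list_all2 (\<lambda>x y. (x, y) \<in> \<theta>) xs ys"
      using that by (auto simp: list_all2_conv_all_nth)
    then have "(interp M f xs, interp M f ys) \<in> \<theta>" by (rule Con_interp[OF assms(2) f])
    then show ?thesis using equiv_class_eq[OF eq] by metis
  qed
  have 2: "list_all2 (\<in>) xs (map (\<lambda>x. \<theta> `` {x}) xs)"
    using xs Con_refl[OF assms(2)] by (auto simp: list.rel_map intro!: list.rel_refl_strong)
  have "{\<theta> `` {interp M f ys} | ys. list_all2 (\<in>) ys (map (\<lambda>x. \<theta> `` {x}) xs)} =
      {\<theta> `` {interp M f xs}}" (is "?S = _")
  proof
    show "?S \<subseteq> {\<theta> `` {interp M f xs}}"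
    proof
      fix X assume "X \<in> ?S"
      then obtain ys where ys: "X = \<theta> `` {interp M f ys}" "list_all2 (\<in>) ys (map (\<lambda>x. \<theta> `` {x}) xs)"
        by blast
      show "X \<in> {\<theta> `` {interp M f xs}}" by (simp only: ys(1) 1[OF ys(2)] singleton_iff)
    qed
    show "{\<theta> `` {interp M f xs}} \<subseteq> ?S" using 2 by blast
  qed
  then show "\<theta> `` {interp M f xs} = interp (quotient_algebra M \<theta>) f (map (\<lambda>x. \<theta> `` {x}) xs)"
    by (simp add: quotient_algebra_def)
qed

lemma quotient_ker:
  assumes "is_algebra F M" "\<theta> \<in> Con F M"
  shows "surj_hom.ker M (\<lambda>x. \<theta> `` {x}) = \<theta>"
proof -
  interpret surj_hom F M "quotient_algebra M \<theta>" "\<lambda>x. \<theta> `` {x}"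
    using assms by (rule quotient_surj_hom)
  show ?thesis
    unfolding ker_def using eq_equiv_class_iff[OF Con_equiv[OF assms(2)]] Con_subset[OF assms(2)] by auto
qed

section \<open>Day terms and the symmetry of the commutator\<close>

text \<open>The valuation for Day's 4-ary terms, on variables 0 to 3. All other variables receive
  \<open>x\<close>, so the identities make sense without restricting the variables of a
  term.\<close>

definition quad :: "'b \<Rightarrow> 'b \<Rightarrow> 'b \<Rightarrow> 'b \<Rightarrow> nat \<Rightarrow> 'b" where
  "quad x y z u = (\<lambda>i. if i = 1 then y else if i = 2 then z else if i = 3 then u else x)"

lemma quad_simps [simp]: "quad x y z u 0 = x" "quad x y z u (Suc 0) = y" "quad x y z u 2 = z" "quad x y z u 3 = u"
  by (simp_all add: quad_def)

lemma quad_apply: "f (quad x y z u i) = quad (f x) (f y) (f z) (f u) i"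
  by (simp add: quad_def)

context univ_algebra
begin

text \<open>Day's terms appear as the vertices of a walk from the variable \<open>x\<close> to the variable \<open>u\<close>. Only one
  of the two identities is required of an edge; the usual alternation of parities is irrelevant.\<close>

definition day_term :: "('f, nat) uterm \<Rightarrow> bool" where
  "day_term m \<longleftrightarrow> wf_term F m \<and> (\<forall>x\<in>carrier M. \<forall>y\<in>carrier M. eval_term M (quad x y y x) m = x)"

definition day_step :: "('f, nat) uterm rel" where
  "day_step = {(m, m'). day_term m \<and> day_term m' \<and>
    ((\<forall>x\<in>carrier M. \<forall>u\<in>carrier M. eval_term M (quad x x u u) m = eval_term M (quad x x u u) m') \<or>
     (\<forall>x\<in>carrier M. \<forall>y\<in>carrier M. \<forall>u\<in>carrier M.
        eval_term M (quad x y y u) m = eval_term M (quad x y y u) m'))}"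

text \<open>Consider m(e(a,c), e(a,y), e(x,y), e(x,c)). For x = a it collapses to e(a,c) by Day's
  identity m(p,q,q,p) = p, both for y = c and for y = d, so that pair lies in \<delta> by
  reflexivity. The term condition then moves x from a to b.\<close>

lemma centralizes_day_pair:
  fixes t :: "('f, 'p + 'q) uterm"
  assumes C: "centralizes F M \<alpha> \<beta> \<delta>" and Con: "\<alpha> \<in> Con F M" "\<beta> \<in> Con F M" "\<delta> \<in> Con F M"
    and t: "wf_term F t" and ab: "\<And>p. (a p, b p) \<in> \<alpha>" and cd: "\<And>q. (c q, d q) \<in> \<beta>" and m: "day_term m"
    and e_def: "\<And>a c. e a c = eval_term M (case_sum a c) t"
  shows "(eval_term M (quad (e a c) (e a c) (e b c) (e b c)) m,
    eval_term M (quad (e a c) (e a d) (e b d) (e b c)) m) \<in> \<delta>"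
proof -
  \<comment> \<open>The variables of each block are doubled: the \<open>Inl\<close> copy stays at
    \<open>a\<close> or \<open>c\<close>, the \<open>Inr\<close> copy is the one that moves.\<close>
  let ?\<sigma> = "\<lambda>f g. case_sum (\<lambda>p. Var (Inl (f p))) (\<lambda>q. Var (Inr (g q))) :: 'p + 'q \<Rightarrow> ('f, ('p + 'p) + ('q + 'q)) uterm"
  define T where "T = subst (quad (subst (?\<sigma> Inl Inl) t) (subst (?\<sigma> Inl Inr) t) (subst (?\<sigma> Inr Inr) t) (subst (?\<sigma> Inr Inl) t)) m"
  have \<sigma>: "(\<lambda>x. eval_term M (case_sum v w) (?\<sigma> f g x)) = case_sum (\<lambda>p. v (f p)) (\<lambda>q. w (g q))"
    for v :: "'p + 'p \<Rightarrow> 'a" and w :: "'q + 'q \<Rightarrow> 'a" and f g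
    by (auto split: sum.split)
  have T: "eval_term M (case_sum (case_sum a x) (case_sum c y)) T = eval_term M (quad (e a c) (e a y) (e x y) (e x c)) m"
    for x y
    unfolding T_def eval_subst quad_apply[of "eval_term M _"] \<sigma> by (simp add: e_def)
  have wf: "wf_term F T"
    unfolding T_def
  proof (rule wf_subst)
    have "wf_term F (subst (?\<sigma> f g) t)" for f g
      using t by (rule wf_subst) (auto split: sum.split)
    then show "wf_term F (quad (subst (?\<sigma> Inl Inl) t) (subst (?\<sigma> Inl Inr) t)
        (subst (?\<sigma> Inr Inr) t) (subst (?\<sigma> Inr Inl) t) i)" for i
      by (simp add: quad_def)
  qed (use m in \<open>simp add: day_term_def\<close>)
  have "(case_sum a a p, case_sum a b p) \<in> \<alpha>" for p
    using ab Con_carrier[OF Con(1) ab] Con_refl[OF Con(1)] by (auto split: sum.split)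
  moreover have "(case_sum c c q, case_sum c d q) \<in> \<beta>" for q
    using cd Con_carrier[OF Con(2) cd] Con_refl[OF Con(2)] by (auto split: sum.split)
  moreover have e: "e v w \<in> carrier M" if "v = a \<or> v = b" "w = c \<or> w = d" for v w
    unfolding e_def using that Con_carrier[OF Con(1) ab] Con_carrier[OF Con(2) cd]
    by (intro eval_term_closed[OF is_algebra t]) (auto split: sum.split)
  then have "eval_term M (quad (e a c) (e a c) (e a c) (e a c)) m = e a c"
    "eval_term M (quad (e a c) (e a d) (e a d) (e a c)) m = e a c" "e a c \<in> carrier M"
    using m unfolding day_term_def by blast+
  ultimately show ?thesis
    using centralizes_valuations[OF C wf, of "case_sum a a" "case_sum a b" "case_sum c c" "case_sum c d"]
    by (simp add: T Con_refl[OF Con(3)])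
qed

end

locale day_algebra = univ_algebra F M
  for F :: "('f \<times> nat) set" and M :: "('f, 'a) algebra" +
  assumes day_walk: "(Var 0, Var 3) \<in> day_step\<^sup>*"
begin

text \<open>Along the walk, the value m(p,q,s,r) starts at p, ends at r and changes only inside
  \<delta>. On an edge agreeing at (p,p,r,r) the assumed pairs bridge the gap; on the other kind,
  replacing s by q does, since (q,s) is in \<delta>.\<close>

lemma day_shift:
  assumes \<delta>: "\<delta> \<in> Con F M" and C: "p \<in> carrier M" "r \<in> carrier M" and qs: "(q, s) \<in> \<delta>"
    and pairs: "\<And>m. day_term m \<Longrightarrow> (eval_term M (quad p p r r) m, eval_term M (quad p q s r) m) \<in> \<delta>"
  shows "(p, r) \<in> \<delta>"
proof -
  have D: "q \<in> carrier M" "s \<in> carrier M" using Con_carrier[OF \<delta> qs] by auto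
  note sym = Con_sym[OF \<delta>] and trans = Con_trans[OF \<delta>]
  have "(p, eval_term M (quad p q s r) m) \<in> \<delta>" if "(Var 0, m) \<in> day_step\<^sup>*" for m
    using that
  proof (induction rule: rtrancl_induct)
    case base
    then show ?case using C Con_refl[OF \<delta>] by simp
  next
    case (step m m')
    have day: "day_term m" "day_term m'" using step.hyps(2) unfolding day_step_def by auto
    have qq: "(eval_term M (quad p q s r) k, eval_term M (quad p q q r) k) \<in> \<delta>" if "day_term k" for k
      using that C D sym[OF qs] Con_refl[OF \<delta>]
      by (intro Con_eval_term[OF \<delta>]) (auto simp: day_term_def quad_def)
    have "(eval_term M (quad p q s r) m, eval_term M (quad p q s r) m') \<in> \<delta>"
    proof (cases "eval_term M (quad p p r r) m = eval_term M (quad p p r r) m'")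
      case True
      then show ?thesis using trans[OF sym[OF pairs[OF day(1)]]] pairs[OF day(2)] by simp
    next
      case False
      then have "eval_term M (quad p q q r) m = eval_term M (quad p q q r) m'"
        using step.hyps(2) C D unfolding day_step_def by blast
      then show ?thesis using trans[OF qq[OF day(1)]] sym[OF qq[OF day(2)]] by simp
    qed
    with step.IH show ?case by (rule trans)
  qed
  from this[OF day_walk] show ?thesis by simp
qed

text \<open>\<open>day_shift\<close> is applied with p = t(a,c), q = t(b,c), s = t(b,d), r = t(a,d);
  its pairs lie in the commutator by \<open>centralizes_day_pair\<close>. Taking \<delta> to be the
  commutator of \<alpha> and \<beta> yields commutativity.\<close>

lemma centralizes_swap:
  assumes Con: "\<alpha> \<in> Con F M" "\<beta> \<in> Con F M" "\<delta> \<in> Con F M" and le: "commutator F M \<alpha> \<beta> \<subseteq> \<delta>"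
  shows "centralizes F M \<beta> \<alpha> \<delta>"
proof -
  obtain z where z: "z \<in> carrier M" using is_algebra unfolding is_algebra_def by blast
  show ?thesis
  proof (rule centralizesI_valuations[OF Con_refl[OF Con(2) z] Con_refl[OF Con(1) z]])
    have *: "(eval_term M (case_sum a c) t, eval_term M (case_sum a d) t) \<in> \<delta>"
      if t: "wf_term F t" and ab: "\<And>i. (a i, b i) \<in> \<beta>" and cd: "\<And>j. (c j, d j) \<in> \<alpha>"
        and bb: "(eval_term M (case_sum b c) t, eval_term M (case_sum b d) t) \<in> \<delta>"
      for t :: "('f, nat + nat) uterm" and a b c d :: "nat \<Rightarrow> 'a"
    proof -
      \<comment> \<open>\<open>centralizes_day_pair\<close> expects the \<alpha>-block on the left,
        whereas \<open>t\<close> carries it on the right.\<close>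
      define t' where "t' = subst (case_sum (\<lambda>i. Var (Inr i)) (\<lambda>i. Var (Inl i)) :: _ \<Rightarrow> ('f, nat + nat) uterm) t"
      have "(\<lambda>x. eval_term M (case_sum u v) (case x of Inl i \<Rightarrow> Var (Inr i) | Inr i \<Rightarrow> Var (Inl i))) = case_sum v u"
        for u v :: "nat \<Rightarrow> 'a"
        by (auto split: sum.split)
      then have t': "eval_term M (case_sum v u) t = eval_term M (case_sum u v) t'" for u v
        unfolding t'_def eval_subst by simp
      have wf: "wf_term F t'"
        unfolding t'_def using t by (rule wf_subst) (auto split: sum.split)
      have closed: "eval_term M (case_sum u v) t \<in> carrier M"
        if "u = a \<or> u = b" "v = c \<or> v = d" for u v
        using that Con_carrier[OF Con(2) ab] Con_carrier[OF Con(1) cd]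
        by (intro eval_term_closed[OF is_algebra t]) (auto split: sum.split)
      show ?thesis
      proof (rule day_shift[OF Con(3) _ _ bb])
        fix m assume m: "day_term m"
        show "(eval_term M (quad (eval_term M (case_sum a c) t) (eval_term M (case_sum a c) t)
              (eval_term M (case_sum a d) t) (eval_term M (case_sum a d) t)) m,
            eval_term M (quad (eval_term M (case_sum a c) t) (eval_term M (case_sum b c) t)
              (eval_term M (case_sum b d) t) (eval_term M (case_sum a d) t)) m) \<in> \<delta>" (is "?P \<in> \<delta>")
        proof -
          \<comment> \<open>Membership in the commutator is checked in each \<mu> of the defining
            intersection, where the term condition is available.\<close>
          have "?P \<in> \<mu>" if "\<mu> \<in> Con F M" "centralizes F M \<alpha> \<beta> \<mu>" for \<mu>
            unfolding t' by (rule centralizes_day_pair[OF that(2) Con(1,2) that(1) wf cd ab m refl])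
          then have "?P \<in> commutator F M \<alpha> \<beta>" unfolding commutator_def by blast
          with le show ?thesis by blast
        qed
      qed (use closed in auto)
    qed
    fix t :: "('f, nat + nat) uterm" and a b c d :: "nat \<Rightarrow> 'a"
    assume t: "wf_term F t" and ab: "\<And>i. (a i, b i) \<in> \<beta>" and cd: "\<And>j. (c j, d j) \<in> \<alpha>"
    show "(eval_term M (case_sum a c) t, eval_term M (case_sum a d) t) \<in> \<delta> \<longleftrightarrow>
        (eval_term M (case_sum b c) t, eval_term M (case_sum b d) t) \<in> \<delta>"
      using *[of t a b c d] *[of t b a c d] t ab cd Con_sym[OF Con(2) ab] by blast
  qed
qed

text \<open>Symmetry is what permits the join with \<open>\<phi>\<close> in the right argument: in general the term condition
  is preserved by joins in its left argument only.\<close>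

lemma centralizes_cjoin:
  assumes Con: "\<alpha> \<in> Con F M" "\<beta> \<in> Con F M" "\<phi> \<in> Con F M" and le: "commutator F M \<alpha> \<beta> \<subseteq> \<phi>"
  shows "centralizes F M (cjoin F M \<phi> \<alpha>) (cjoin F M \<phi> \<beta>) \<phi>"
proof -
  have left: "centralizes F M (cjoin F M \<phi> \<alpha>) \<beta> \<phi>"
    if "\<alpha> \<in> Con F M" "\<beta> \<in> Con F M" "centralizes F M \<alpha> \<beta> \<phi>" for \<alpha> \<beta>
    using that Con(3) by (intro centralizes_cjoin_left centralizes_self_left)
  have swap: "centralizes F M \<beta> \<alpha> \<phi>"
    if "\<alpha> \<in> Con F M" "\<beta> \<in> Con F M" "centralizes F M \<alpha> \<beta> \<phi>" for \<alpha> \<beta>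
    by (rule centralizes_swap[OF that(1,2) Con(3) commutator_least[OF Con(3) that(3)]])
  note join = cjoin_Con[OF Con(3)]
  have "centralizes F M (cjoin F M \<phi> \<beta>) \<alpha> \<phi>"
    by (rule left[OF Con(2,1) centralizes_swap[OF Con le]])
  then have "centralizes F M \<alpha> (cjoin F M \<phi> \<beta>) \<phi>"
    by (rule swap[OF join[OF Con(2)] Con(1)])
  then show ?thesis
    by (rule left[OF Con(1) join[OF Con(2)]])
qed

end

section \<open>Day's terms from a relatively free algebra\<close>

lemma kernel_Con:
  "{(s, t). wf_term F s \<and> wf_term F t \<and> (\<forall>v\<in>P. eval_term A v s = eval_term A v t)} \<in> Con F (term_algebra F)"
    (is "?K \<in> _")
proof (rule ConI)
  show "(interp (term_algebra F) f xs, interp (term_algebra F) f ys) \<in> ?K"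
    if f: "(f, length xs) \<in> F" and l: "list_all2 (\<lambda>s t. (s, t) \<in> ?K) xs ys" for f xs ys
  proof -
    have "\<forall>s\<in>set xs. wf_term F s" "\<forall>t\<in>set ys. wf_term F t"
      "\<forall>v\<in>P. map (eval_term A v) xs = map (eval_term A v) ys"
      using l by (induction rule: list_all2_induct) auto
    with f list_all2_lengthD[OF l] show ?thesis by (auto simp del: map_eq_conv)
  qed
qed auto

lemma term_algebra_is_algebra: "is_algebra F (term_algebra F)"
proof -
  have "Var undefined \<in> carrier (term_algebra F)" by simp
  then have "carrier (term_algebra F) \<noteq> {}" by blast
  then show ?thesis unfolding is_algebra_def closed_under_def by auto
qed

text \<open>Day's argument in the relatively free algebra \<open>N\<close> of the variety generated by \<open>A\<close>. Its three
  congruences need not be principal: kernels of families of valuations in \<open>A\<close> do as well.\<close>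

lemma modular_day_walk:
  fixes A :: "('f, 'a) algebra"
  assumes wfE: "wf_identities F E"
    and mod: "congruence_modular F (variety F E :: ('f, ('f, 'a) universe) algebra set)"
    and A: "A \<in> variety F E"
  shows "(Var 0, Var 3) \<in> (univ_algebra.day_step F A)\<^sup>*"
proof -
  have algA: "is_algebra F A" using A unfolding variety_def by blast
  interpret A: univ_algebra F A by unfold_locales fact
  define T :: "('f, ('f, 'a + nat) uterm) algebra" where "T = term_algebra F"
  \<comment> \<open>\<open>K V\<close> consists of the identities of \<open>A\<close> in the
    generators \<open>'a + nat\<close>, so the quotient by it has its carrier in
    \<open>universe\<close>, where modularity is assumed.\<close>
  define V where "V = {v :: 'a + nat \<Rightarrow> 'a. range v \<subseteq> carrier A}"
  define K where "K P = {(s, t). wf_term F s \<and> wf_term F t \<and> (\<forall>v\<in>P. eval_term A v s = eval_term A v t)}"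
    for P :: "('a + nat \<Rightarrow> 'a) set"
  have K_Con: "K P \<in> Con F T" for P unfolding K_def T_def by (rule kernel_Con)
  have K_anti: "K Q \<subseteq> K P" if "P \<subseteq> Q" for P Q using that unfolding K_def by blast
  define N where "N = quotient_algebra T (K V)"
  define h where "h x = K V `` {x}" for x
  have algT: "is_algebra F T" unfolding T_def by (rule term_algebra_is_algebra)
  have h_fun: "h = (\<lambda>x. K V `` {x})" by (simp add: h_def fun_eq_iff)
  interpret surj_hom F T N h
    unfolding N_def h_fun by (rule quotient_surj_hom[OF algT K_Con])
  have ker: "ker = K V" unfolding h_fun by (rule quotient_ker[OF algT K_Con])
  have N: "N \<in> variety F E"
  proof (rule varietyI[OF cod.is_algebra])
    fix s t :: "('f, nat) uterm" and v :: "nat \<Rightarrow> ('f, 'a + nat) uterm set"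
    assume st: "(s, t) \<in> E" and v: "range v \<subseteq> carrier N"
    have wf: "wf_term F s" "wf_term F t" using wfE st unfolding wf_identities_def by auto
    have "\<forall>i. \<exists>x. x \<in> carrier T \<and> v i = h x" using v unfolding onto[symmetric] by blast
    then obtain \<sigma> where \<sigma>: "\<And>i. \<sigma> i \<in> carrier T" "\<And>i. v i = h (\<sigma> i)" by metis
    then have v_eq: "v = (\<lambda>i. h (\<sigma> i))" by blast
    have subst: "eval_term T \<sigma> r = subst \<sigma> r" for r unfolding T_def by (induction r) (simp_all cong: map_cong)
    have "eval_term A w (subst \<sigma> s) = eval_term A w (subst \<sigma> t)" if "w \<in> V" for w
    proof -
      have "eval_term A w (\<sigma> i) \<in> carrier A" for i
        using \<sigma>(1)[of i] \<open>w \<in> V\<close> by (intro eval_term_closed[OF algA]) (auto simp: T_def V_def)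
      then have "range (\<lambda>i. eval_term A w (\<sigma> i)) \<subseteq> carrier A" by blast
      then show ?thesis
        using A st unfolding eval_subst variety_def by blast
    qed
    moreover have "wf_term F (subst \<sigma> r)" if "wf_term F r" for r
      using that \<sigma>(1) by (intro wf_subst) (auto simp: T_def)
    ultimately have "(subst \<sigma> s, subst \<sigma> t) \<in> ker" unfolding ker K_def using wf by blast
    then show "eval_term N v s = eval_term N v t"
      using hom_eval_term[OF wf(1), of \<sigma>] hom_eval_term[OF wf(2), of \<sigma>] \<sigma>(1)
      unfolding ker_def by (simp add: v_eq subst)
  qed
  define x where "x i = (Var (Inr i) :: ('f, 'a + nat) uterm)" for i
  \<comment> \<open>Day's configuration: \<alpha> identifies x1 with x2; \<beta> identifies x0 with
    x1 and x2 with x3; \<gamma> identifies x0 with x3 and x1 with x2. Then \<alpha> \<subseteq>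
    \<gamma>, and (x0, x3) lies in \<gamma> and, by way of x1 and x2, in the join of \<alpha> and
    \<beta>. Modularity puts it into the join of \<alpha> and \<beta> \<inter> \<gamma>.\<close>
  define P\<gamma> where "P\<gamma> = {v \<in> V. v (Inr 0) = v (Inr 3) \<and> v (Inr 1) = v (Inr 2)}"
  define P\<alpha> where "P\<alpha> = {v \<in> V. v (Inr 1) = v (Inr 2)}"
  define P\<beta> where "P\<beta> = {v \<in> V. v (Inr 0) = v (Inr 1) \<and> v (Inr 2) = v (Inr 3)}"
  have ker_le: "ker \<subseteq> K P\<alpha>" "ker \<subseteq> K P\<beta>" "ker \<subseteq> K P\<gamma>"
    unfolding ker P\<alpha>_def P\<beta>_def P\<gamma>_def by (rule K_anti, rule Collect_restrict)+
  have \<alpha>\<gamma>: "K P\<alpha> \<subseteq> K P\<gamma>" by (rule K_anti) (auto simp: P\<alpha>_def P\<gamma>_def)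
  note pushes = push_Con[OF K_Con ker_le(1)] push_Con[OF K_Con ker_le(2)] push_Con[OF K_Con ker_le(3)]
  have "push (K P\<alpha>) \<subseteq> push (K P\<gamma>)" using \<alpha>\<gamma> unfolding push_def by blast
  then have "cjoin F N (push (K P\<alpha>)) (push (K P\<beta>) \<inter> push (K P\<gamma>)) =
      cjoin F N (push (K P\<alpha>)) (push (K P\<beta>)) \<inter> push (K P\<gamma>)"
    using mod N pushes unfolding congruence_modular_def by blast
  \<comment> \<open>\<open>pull\<close> respects joins and meets, so the modular law, known for
    \<open>N\<close>, carries over to these kernels on the term algebra.\<close>
  moreover have "pull (\<mu> \<inter> \<nu>) = pull \<mu> \<inter> pull \<nu>" for \<mu> \<nu> unfolding pull_def by blast
  ultimately have "cjoin F T (K P\<alpha>) (K P\<beta> \<inter> K P\<gamma>) = cjoin F T (K P\<alpha>) (K P\<beta>) \<inter> K P\<gamma>"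
    using pull_cjoin[OF pushes(1) Inter_Con2[OF pushes(2,3)]] pull_cjoin[OF pushes(1,2)]
    by (simp add: pull_push[OF K_Con] ker_le)
  moreover have "(x 0, x 3) \<in> cjoin F T (K P\<alpha>) (K P\<beta>)"
  proof -
    have "(x 0, x 1) \<in> K P\<beta>" "(x 1, x 2) \<in> K P\<alpha>" "(x 2, x 3) \<in> K P\<beta>"
      unfolding K_def P\<alpha>_def P\<beta>_def x_def by auto
    then show ?thesis unfolding dom.cjoin_eq_trancl[OF K_Con K_Con]
      by (meson UnI1 UnI2 trancl.trancl_into_trancl r_into_trancl)
  qed
  moreover have "(x 0, x 3) \<in> K P\<gamma>" unfolding K_def P\<gamma>_def x_def by auto
  ultimately have "(x 0, x 3) \<in> (K P\<alpha> \<union> (K P\<beta> \<inter> K P\<gamma>))\<^sup>+"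
    using dom.cjoin_eq_trancl[OF K_Con Inter_Con2[OF K_Con K_Con]] by blast
  then have walk: "(x 0, x 3) \<in> (K P\<alpha> \<union> (K P\<beta> \<inter> K P\<gamma>))\<^sup>*" by (rule trancl_into_rtrancl)
  \<comment> \<open>The walk runs through terms over \<open>'a + nat\<close>, but
    \<open>day_step\<close> wants variables in \<open>nat\<close>: generators from \<open>'a\<close>
    become variable 0, and \<open>val\<close> evaluates them accordingly.\<close>
  define \<rho> where "\<rho> = subst (case_sum (\<lambda>_. Var 0) Var :: 'a + nat \<Rightarrow> ('f, nat) uterm)"
  define val :: "(nat \<Rightarrow> 'a) \<Rightarrow> 'a + nat \<Rightarrow> 'a" where "val w = case_sum (\<lambda>_. w 0) w" for w :: "nat \<Rightarrow> 'a"
  have \<rho>_eval: "eval_term A w (\<rho> t) = eval_term A (val w) t" for w t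
    unfolding \<rho>_def eval_subst val_def by (rule eval_term_cong) (auto split: sum.split)
  have \<rho>_wf: "wf_term F (\<rho> t)" if "wf_term F t" for t
    unfolding \<rho>_def using that by (rule wf_subst) (auto split: sum.split)
  have val: "val (quad p q r s) \<in> V" if "p \<in> carrier A" "q \<in> carrier A" "r \<in> carrier A" "s \<in> carrier A" for p q r s
    using that unfolding val_def V_def by (auto split: sum.split simp: quad_def)
  have \<rho>_day: "A.day_term (\<rho> t)" if t: "(x 0, t) \<in> K P\<gamma>" for t
    unfolding A.day_term_def
  proof (intro conjI ballI)
    show "wf_term F (\<rho> t)" using t \<rho>_wf unfolding K_def by blast
    fix p q assume "p \<in> carrier A" "q \<in> carrier A"
    then have "val (quad p q q p) \<in> P\<gamma>" using val unfolding P\<gamma>_def val_def by simp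
    then have "eval_term A (val (quad p q q p)) (x 0) = eval_term A (val (quad p q q p)) t"
      using t unfolding K_def by blast
    then show "eval_term A (quad p q q p) (\<rho> t) = p" by (simp add: \<rho>_eval x_def val_def)
  qed
  \<comment> \<open>Every vertex stays in the \<gamma>-class of x0, which is the identity m(x,y,y,x)
    = x. An edge in \<alpha> gives agreement at (x,y,y,u), an edge in \<beta> agreement at
    (x,x,u,u).\<close>
  have "(x 0, t) \<in> K P\<gamma> \<and> (Var 0, \<rho> t) \<in> A.day_step\<^sup>*"
    if "(x 0, t) \<in> (K P\<alpha> \<union> (K P\<beta> \<inter> K P\<gamma>))\<^sup>*" for t
    using that
  proof (induction rule: rtrancl_induct)
    case base
    then show ?case by (auto simp: K_def x_def \<rho>_def)
  next
    case (step s t)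
    then have s: "(x 0, s) \<in> K P\<gamma>" and "(s, t) \<in> K P\<gamma>" using \<alpha>\<gamma> by auto
    then have t: "(x 0, t) \<in> K P\<gamma>" by (rule Con_trans[OF K_Con])
    have "(\<forall>p\<in>carrier A. \<forall>u\<in>carrier A. eval_term A (quad p p u u) (\<rho> s) = eval_term A (quad p p u u) (\<rho> t)) \<or>
     (\<forall>p\<in>carrier A. \<forall>q\<in>carrier A. \<forall>u\<in>carrier A. eval_term A (quad p q q u) (\<rho> s) = eval_term A (quad p q q u) (\<rho> t))"
      (is "?B \<or> ?A")
    proof (cases "(s, t) \<in> K P\<alpha>")
      case True
      have "val (quad p q q u) \<in> P\<alpha>" if "p \<in> carrier A" "q \<in> carrier A" "u \<in> carrier A" for p q u
        using val that unfolding P\<alpha>_def val_def by simp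
      then have ?A using True unfolding K_def \<rho>_eval by blast
      then show ?thesis ..
    next
      case False
      then have "(s, t) \<in> K P\<beta>" using step.hyps(2) by blast
      moreover have "val (quad p p u u) \<in> P\<beta>" if "p \<in> carrier A" "u \<in> carrier A" for p u
        using val that unfolding P\<beta>_def val_def by simp
      ultimately have ?B unfolding K_def \<rho>_eval by blast
      then show ?thesis ..
    qed
    then have "(\<rho> s, \<rho> t) \<in> A.day_step"
      using \<rho>_day[OF s] \<rho>_day[OF t] unfolding A.day_step_def by blast
    with step.IH t show ?case by (auto intro: rtrancl_into_rtrancl)
  qed
  from this[OF walk] show ?thesis by (simp add: \<rho>_def x_def)
qed

section \<open>Prime congruences and the reticulation\<close>

lemma directed_finite_subset:
  assumes "\<S> \<noteq> {}" "\<And>\<alpha> \<beta>. \<alpha> \<in> \<S> \<Longrightarrow> \<beta> \<in> \<S> \<Longrightarrow> \<exists>\<gamma>\<in>\<S>. \<alpha> \<union> \<beta> \<subseteq> \<gamma>"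
  shows "finite X \<Longrightarrow> X \<subseteq> \<Union>\<S> \<Longrightarrow> \<exists>\<gamma>\<in>\<S>. X \<subseteq> \<gamma>"
proof (induction X rule: finite_induct)
  case empty
  then show ?case using assms(1) by auto
next
  case (insert x X)
  then obtain \<alpha> \<beta> where ab: "X \<subseteq> \<alpha>" "\<alpha> \<in> \<S>" "x \<in> \<beta>" "\<beta> \<in> \<S>" by auto
  then obtain \<gamma> where "\<gamma> \<in> \<S>" "\<alpha> \<union> \<beta> \<subseteq> \<gamma>" using assms(2)[of \<alpha> \<beta>] by blast
  with ab show ?case by (intro bexI[of _ \<gamma>]) auto
qed

lemma SpecD:
  assumes "\<phi> \<in> Spec F M"
  shows "\<phi> \<in> Con F M" "\<phi> \<noteq> nabla M"
    "\<alpha> \<in> Con F M \<Longrightarrow> \<beta> \<in> Con F M \<Longrightarrow> commutator F M \<alpha> \<beta> \<subseteq> \<phi> \<Longrightarrow> \<alpha> \<subseteq> \<phi> \<or> \<beta> \<subseteq> \<phi>"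
  using assms unfolding Spec_def by blast+

text \<open>The closed set V(\<alpha>) of the prime spectrum; classes of the reticulation are
  compared through it.\<close>

definition primes_above :: "('f \<times> nat) set \<Rightarrow> ('f, 'a) algebra \<Rightarrow> 'a rel \<Rightarrow> 'a rel set" where
  "primes_above F M \<alpha> = {\<phi> \<in> Spec F M. \<alpha> \<subseteq> \<phi>}"

context univ_algebra
begin

text \<open>The radical is computed from the primes above a congruence, and conversely these primes
  are exactly the primes above its radical.\<close>

lemma radical_eq_iff:
  assumes "\<alpha> \<in> Con F M" "\<beta> \<in> Con F M"
  shows "radical F M \<alpha> = radical F M \<beta> \<longleftrightarrow> primes_above F M \<alpha> = primes_above F M \<beta>"
proof
  have "primes_above F M \<gamma> = {\<phi> \<in> Spec F M. radical F M \<gamma> \<subseteq> \<phi>}" if "\<gamma> \<in> Con F M" for \<gamma>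
    using Con_subset[OF that] unfolding primes_above_def radical_def by blast
  then show "radical F M \<alpha> = radical F M \<beta> \<Longrightarrow> primes_above F M \<alpha> = primes_above F M \<beta>"
    using assms by simp
qed (simp add: radical_def primes_above_def)

lemma hat_eq:
  "\<alpha> \<in> Con F M \<Longrightarrow> hat F M \<alpha> = {\<beta> \<in> Con F M. primes_above F M \<beta> = primes_above F M \<alpha>}"
  unfolding hat_def using radical_eq_iff by blast

lemma hat_eq_iff:
  "\<alpha> \<in> Con F M \<Longrightarrow> \<beta> \<in> Con F M \<Longrightarrow>
    hat F M \<alpha> = hat F M \<beta> \<longleftrightarrow> primes_above F M \<alpha> = primes_above F M \<beta>"
  using hat_eq by blast

lemma primes_above_cjoin:
  "primes_above F M (cjoin F M \<alpha> \<beta>) = primes_above F M \<alpha> \<inter> primes_above F M \<beta>"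
  unfolding primes_above_def by (auto simp: cjoin_subset_iff[OF SpecD(1)] cong: conj_cong)

lemma primes_above_commutator:
  assumes "\<alpha> \<in> Con F M" "\<beta> \<in> Con F M"
  shows "primes_above F M (commutator F M \<alpha> \<beta>) = primes_above F M \<alpha> \<union> primes_above F M \<beta>"
  unfolding primes_above_def using commutator_subset[OF assms] SpecD(3)[OF _ assms] by blast

lemma reticulation_carrier: "carrier (reticulation F M) = hat F M ` fg_con F M"
  by (simp add: reticulation_def)

text \<open>Well-definedness of join and meet at once: an operation that respects sets of primes
  contributes the same class for all representatives, and \<alpha>, \<beta> themselves keep the
  union from being empty.\<close>

lemma UN_hat:
  assumes \<alpha>: "\<alpha> \<in> fg_con F M" and \<beta>: "\<beta> \<in> fg_con F M"
    and op: "\<And>\<alpha> \<beta>. \<alpha> \<in> Con F M \<Longrightarrow> \<beta> \<in> Con F M \<Longrightarrow> op \<alpha> \<beta> \<in> Con F M"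
    and cong: "\<And>\<alpha> \<beta> \<alpha>' \<beta>'. \<alpha> \<in> Con F M \<Longrightarrow> \<beta> \<in> Con F M \<Longrightarrow> \<alpha>' \<in> Con F M \<Longrightarrow> \<beta>' \<in> Con F M \<Longrightarrow>
      primes_above F M \<alpha>' = primes_above F M \<alpha> \<Longrightarrow> primes_above F M \<beta>' = primes_above F M \<beta> \<Longrightarrow>
      primes_above F M (op \<alpha>' \<beta>') = primes_above F M (op \<alpha> \<beta>)"
  shows "(\<Union>\<alpha>'\<in>hat F M \<alpha> \<inter> fg_con F M. \<Union>\<beta>'\<in>hat F M \<beta> \<inter> fg_con F M. hat F M (op \<alpha>' \<beta>')) = hat F M (op \<alpha> \<beta>)"
proof -
  note Con = fg_con_Con[OF \<alpha>] fg_con_Con[OF \<beta>]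
  have "hat F M (op \<alpha>' \<beta>') = hat F M (op \<alpha> \<beta>)" if "\<alpha>' \<in> hat F M \<alpha>" "\<beta>' \<in> hat F M \<beta>" for \<alpha>' \<beta>'
  proof -
    have *: "\<alpha>' \<in> Con F M" "primes_above F M \<alpha>' = primes_above F M \<alpha>"
      "\<beta>' \<in> Con F M" "primes_above F M \<beta>' = primes_above F M \<beta>"
      using that Con by (simp_all add: hat_eq)
    then show ?thesis
      using hat_eq_iff[OF op[OF *(1,3)] op[OF Con]] cong[OF Con *(1,3,2,4)] by blast
  qed
  moreover have "\<alpha> \<in> hat F M \<alpha>" "\<beta> \<in> hat F M \<beta>" using Con by (simp_all add: hat_eq)
  ultimately show ?thesis using \<alpha> \<beta> by blast
qed

lemma reticulation_join:
  assumes "\<alpha> \<in> fg_con F M" "\<beta> \<in> fg_con F M"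
  shows "ljoin (reticulation F M) (hat F M \<alpha>) (hat F M \<beta>) = hat F M (cjoin F M \<alpha> \<beta>)"
  unfolding reticulation_def lat.simps
  by (rule UN_hat[OF assms cjoin_Con]) (simp_all add: primes_above_cjoin)

lemma reticulation_meet:
  assumes "\<alpha> \<in> fg_con F M" "\<beta> \<in> fg_con F M"
  shows "lmeet (reticulation F M) (hat F M \<alpha>) (hat F M \<beta>) = hat F M (commutator F M \<alpha> \<beta>)"
  unfolding reticulation_def lat.simps
  by (rule UN_hat[OF assms commutator_Con]) (simp_all add: primes_above_commutator)

text \<open>The join of \<beta> and \<theta> is the directed union of the congruences generated by
  \<beta> and a finite \<open>Y\<close> inside \<theta>; the finitely many generators of \<alpha>
  already lie in one of them.\<close>

lemma compact_below_cjoin: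
  assumes "\<alpha> \<in> fg_con F M" "\<beta> \<in> Con F M" "\<theta> \<in> Con F M" and le: "\<alpha> \<subseteq> cjoin F M \<beta> \<theta>"
  shows "\<exists>\<gamma>\<in>fg_con F M. \<gamma> \<subseteq> \<theta> \<and> \<alpha> \<subseteq> cjoin F M \<beta> \<gamma>"
proof -
  obtain X where X: "finite X" "\<alpha> = Cg F M X" using assms(1) unfolding fg_con_def by auto
  define \<S> where "\<S> = (\<lambda>Y. Cg F M (\<beta> \<union> Y)) ` {Y. finite Y \<and> Y \<subseteq> \<theta>}"
  have nab: "\<beta> \<subseteq> nabla M" "\<theta> \<subseteq> nabla M" using assms(2,3) by (auto dest: Con_carrier)
  have Con: "Cg F M (\<beta> \<union> Y) \<in> Con F M" if "Y \<subseteq> \<theta>" for Y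
    using nab that by (intro Cg_Con) auto
  have mono: "Cg F M (\<beta> \<union> Y) \<subseteq> Cg F M (\<beta> \<union> Z)" if "Y \<subseteq> Z" "Z \<subseteq> \<theta>" for Y Z
    using that Cg_superset[of "\<beta> \<union> Z"] by (intro Cg_least Con) auto
  have ne: "\<S> \<noteq> {}" unfolding \<S>_def by blast
  have dir: "\<exists>\<kappa>\<in>\<S>. \<mu> \<union> \<nu> \<subseteq> \<kappa>" if "\<mu> \<in> \<S>" "\<nu> \<in> \<S>" for \<mu> \<nu>
  proof -
    obtain Y Z where YZ: "\<mu> = Cg F M (\<beta> \<union> Y)" "\<nu> = Cg F M (\<beta> \<union> Z)" "finite (Y \<union> Z)" "Y \<union> Z \<subseteq> \<theta>"
      using \<open>\<mu> \<in> \<S>\<close> \<open>\<nu> \<in> \<S>\<close> unfolding \<S>_def by auto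
    then have "\<mu> \<union> \<nu> \<subseteq> Cg F M (\<beta> \<union> (Y \<union> Z))" using mono[of _ "Y \<union> Z"] by simp
    moreover have "Cg F M (\<beta> \<union> (Y \<union> Z)) \<in> \<S>" using YZ unfolding \<S>_def by blast
    ultimately show ?thesis by blast
  qed
  have "\<Union>\<S> \<in> Con F M"
    using ne dir by (intro directed_Union_Con) (auto simp: \<S>_def Con)
  moreover have "\<beta> \<subseteq> \<Union>\<S>" using Cg_superset[of "\<beta> \<union> {}"] unfolding \<S>_def by blast
  moreover have "\<theta> \<subseteq> \<Union>\<S>"
  proof
    fix p assume "p \<in> \<theta>"
    then have "Cg F M (\<beta> \<union> {p}) \<in> \<S>" unfolding \<S>_def by blast
    moreover have "p \<in> Cg F M (\<beta> \<union> {p})" using Cg_superset[of "\<beta> \<union> {p}"] by blast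
    ultimately show "p \<in> \<Union>\<S>" by blast
  qed
  ultimately have "X \<subseteq> \<Union>\<S>"
    using le Cg_superset[of X] X(2) cjoin_subset_iff by blast
  then obtain Y where Y: "finite Y" "Y \<subseteq> \<theta>" "X \<subseteq> Cg F M (\<beta> \<union> Y)"
    using directed_finite_subset[OF ne dir X(1)] unfolding \<S>_def by auto
  have Y_nab: "Y \<subseteq> nabla M" using Y nab by blast
  have "\<beta> \<union> Y \<subseteq> cjoin F M \<beta> (Cg F M Y)"
    using cjoin_ge Cg_superset[of Y] by blast
  then have "Cg F M (\<beta> \<union> Y) \<subseteq> cjoin F M \<beta> (Cg F M Y)"
    by (intro Cg_least cjoin_Con assms(2) Cg_Con Y_nab)
  then have "\<alpha> \<subseteq> cjoin F M \<beta> (Cg F M Y)"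
    unfolding X(2) using Y(3) by (intro Cg_least cjoin_Con assms(2) Cg_Con Y_nab) blast
  then show ?thesis
    using Y Y_nab Cg_least[OF assms(3) Y(2)] unfolding fg_con_def by blast
qed

text \<open>Iterated squares, as in a derived series. They decrease, so any two have a common lower
  one, whose commutator with itself is again a member of the sequence.\<close>

primrec cpower :: "'a rel \<Rightarrow> nat \<Rightarrow> 'a rel" where
  "cpower \<alpha> 0 = \<alpha>"
| "cpower \<alpha> (Suc n) = commutator F M (cpower \<alpha> n) (cpower \<alpha> n)"

lemma cpower_Con: "\<alpha> \<in> Con F M \<Longrightarrow> cpower \<alpha> n \<in> Con F M"
  by (induction n) (auto intro: commutator_Con)

lemma cpower_antimono: "m \<le> n \<Longrightarrow> \<alpha> \<in> Con F M \<Longrightarrow> cpower \<alpha> n \<subseteq> cpower \<alpha> m"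
proof (induction rule: dec_induct)
  case (step n)
  have "cpower \<alpha> (Suc n) \<subseteq> cpower \<alpha> n"
    using commutator_subset[OF cpower_Con[OF \<open>\<alpha> \<in> Con F M\<close>] cpower_Con[OF \<open>\<alpha> \<in> Con F M\<close>]] by auto
  with step show ?case by blast
qed simp

lemma Spec_cpower: "\<phi> \<in> Spec F M \<Longrightarrow> \<alpha> \<in> Con F M \<Longrightarrow> cpower \<alpha> n \<subseteq> \<phi> \<Longrightarrow> \<alpha> \<subseteq> \<phi>"
  by (induction n) (auto dest: SpecD(3)[OF _ cpower_Con cpower_Con])

end

locale compact_commutator_algebra = day_algebra +
  assumes commutator_fg_con: "\<alpha> \<in> fg_con F M \<Longrightarrow> \<beta> \<in> fg_con F M \<Longrightarrow> commutator F M \<alpha> \<beta> \<in> fg_con F M"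
begin

lemma cpower_fg_con: "\<alpha> \<in> fg_con F M \<Longrightarrow> cpower \<alpha> n \<in> fg_con F M"
  by (induction n) (auto intro: commutator_fg_con)

text \<open>A congruence that is maximal above \<open>\<delta>\<close> among those containing no commutator power of \<open>\<alpha>\<close> is
  prime; Zorn's lemma applies because these powers are compact.\<close>

lemma cpower_subset_of_radical:
  assumes \<alpha>: "\<alpha> \<in> fg_con F M" and \<delta>: "\<delta> \<in> Con F M" and le: "primes_above F M \<delta> \<subseteq> primes_above F M \<alpha>"
  shows "\<exists>n. cpower \<alpha> n \<subseteq> \<delta>"
proof (rule ccontr)
  assume no: "\<not> ?thesis"
  note \<alpha>C = fg_con_Con[OF \<alpha>]
  define \<S> where "\<S> = {\<phi> \<in> Con F M. \<delta> \<subseteq> \<phi> \<and> (\<forall>n. \<not> cpower \<alpha> n \<subseteq> \<phi>)}"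
  have "\<exists>\<phi>\<in>\<S>. \<forall>\<psi>\<in>\<S>. \<phi> \<subseteq> \<psi> \<longrightarrow> \<psi> = \<phi>"
  proof (rule subset_Zorn_nonempty)
    show "\<S> \<noteq> {}" using no \<delta> unfolding \<S>_def by blast
    fix \<C> assume ne: "\<C> \<noteq> {}" and chain: "subset.chain \<S> \<C>"
    have sub: "\<C> \<subseteq> \<S>" using chain unfolding subset.chain_def by blast
    have dir: "\<exists>\<gamma>\<in>\<C>. \<mu> \<union> \<nu> \<subseteq> \<gamma>" if "\<mu> \<in> \<C>" "\<nu> \<in> \<C>" for \<mu> \<nu>
      using chain that unfolding subset_chain_def by (metis Un_absorb1 Un_absorb2 subset_refl)
    have Un: "\<Union>\<C> \<in> Con F M"
      using ne dir sub unfolding \<S>_def by (intro directed_Union_Con) auto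
    have "\<not> cpower \<alpha> n \<subseteq> \<Union>\<C>" for n
    proof
      assume *: "cpower \<alpha> n \<subseteq> \<Union>\<C>"
      obtain X where X: "finite X" "cpower \<alpha> n = Cg F M X"
        using cpower_fg_con[OF \<alpha>, of n] unfolding fg_con_def by blast
      have "X \<subseteq> \<Union>\<C>" using * Cg_superset[of X] X(2) by simp
      then obtain \<gamma> where "\<gamma> \<in> \<C>" "X \<subseteq> \<gamma>" using directed_finite_subset[OF ne dir X(1)] by blast
      moreover from this have "\<gamma> \<in> Con F M" "\<not> cpower \<alpha> n \<subseteq> \<gamma>" using sub unfolding \<S>_def by auto
      ultimately show False using X(2) Cg_least[of \<gamma> X] by simp
    qed
    with Un ne sub show "\<Union>\<C> \<in> \<S>" unfolding \<S>_def by blast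
  qed
  then obtain \<phi> where \<phi>: "\<phi> \<in> \<S>" and max: "\<And>\<psi>. \<psi> \<in> \<S> \<Longrightarrow> \<phi> \<subseteq> \<psi> \<Longrightarrow> \<psi> = \<phi>" by blast
  have \<phi>C: "\<phi> \<in> Con F M" "\<delta> \<subseteq> \<phi>" and \<phi>n: "\<And>n. \<not> cpower \<alpha> n \<subseteq> \<phi>" using \<phi> unfolding \<S>_def by auto
  have "\<phi> \<in> Spec F M"
    unfolding Spec_def
  proof (intro CollectI conjI ballI impI)
    show "\<phi> \<in> Con F M" by (rule \<phi>C)
    \<comment> \<open>The power with index 0 is \<alpha> itself, which lies below
      \<open>nabla M\<close>.\<close>
    show "\<phi> \<noteq> nabla M" using \<phi>n[of 0] Con_subset[OF \<alpha>C] by auto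
    fix \<beta> \<gamma> assume \<beta>\<gamma>: "\<beta> \<in> Con F M" "\<gamma> \<in> Con F M" and comm: "commutator F M \<beta> \<gamma> \<subseteq> \<phi>"
    show "\<beta> \<subseteq> \<phi> \<or> \<gamma> \<subseteq> \<phi>"
    proof (rule ccontr)
      assume "\<not> ?thesis"
      then have nle: "\<not> \<beta> \<subseteq> \<phi>" "\<not> \<gamma> \<subseteq> \<phi>" by auto
      \<comment> \<open>By maximality of \<phi>, a proper enlargement leaves the family, and the
        only way to do so is to contain a power of \<alpha>.\<close>
      have power: "\<exists>n. cpower \<alpha> n \<subseteq> cjoin F M \<phi> \<kappa>" if \<kappa>: "\<kappa> \<in> Con F M" "\<not> \<kappa> \<subseteq> \<phi>" for \<kappa>
      proof (rule ccontr)
        assume "\<not> ?thesis"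
        then have "cjoin F M \<phi> \<kappa> \<in> \<S>"
          using cjoin_Con[OF \<phi>C(1) \<kappa>(1)] cjoin_ge(1)[of \<phi> \<kappa>] \<phi>C(2) unfolding \<S>_def by blast
        then show False using max[OF _ cjoin_ge(1)] cjoin_ge(2)[of \<kappa> \<phi>] \<kappa>(2) by blast
      qed
      obtain m n where "cpower \<alpha> m \<subseteq> cjoin F M \<phi> \<beta>" "cpower \<alpha> n \<subseteq> cjoin F M \<phi> \<gamma>"
        using power[OF \<beta>\<gamma>(1) nle(1)] power[OF \<beta>\<gamma>(2) nle(2)] by blast
      \<comment> \<open>With one exponent for both joins, the next power lies in the commutator of
        the joins, which \<open>centralizes_cjoin\<close> puts below \<phi>.\<close>
      then have "cpower \<alpha> (max m n) \<subseteq> cjoin F M \<phi> \<beta>" "cpower \<alpha> (max m n) \<subseteq> cjoin F M \<phi> \<gamma>"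
        using cpower_antimono[OF _ \<alpha>C, of m "max m n"] cpower_antimono[OF _ \<alpha>C, of n "max m n"] by auto
      then have "cpower \<alpha> (Suc (max m n)) \<subseteq> commutator F M (cjoin F M \<phi> \<beta>) (cjoin F M \<phi> \<gamma>)"
        unfolding cpower.simps by (rule commutator_mono)
      also have "\<dots> \<subseteq> \<phi>"
        using \<phi>C(1) centralizes_cjoin[OF \<beta>\<gamma> \<phi>C(1) comm] by (rule commutator_least)
      finally show False using \<phi>n by blast
    qed
  qed
  then have "\<alpha> \<subseteq> \<phi>" using le \<phi>C(2) unfolding primes_above_def by blast
  with \<phi>n[of 0] show False by simp
qed

lemma compact_below_radical:
  assumes \<alpha>: "\<alpha> \<in> fg_con F M" and \<beta>: "\<beta> \<in> fg_con F M" and \<theta>: "\<theta> \<in> Con F M"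
    and le: "primes_above F M \<beta> \<inter> primes_above F M \<theta> \<subseteq> primes_above F M \<alpha>"
  shows "\<exists>\<gamma>\<in>fg_con F M. \<gamma> \<subseteq> \<theta> \<and> primes_above F M \<beta> \<inter> primes_above F M \<gamma> \<subseteq> primes_above F M \<alpha>"
proof -
  note Con = fg_con_Con[OF \<alpha>] fg_con_Con[OF \<beta>]
  obtain n where "cpower \<alpha> n \<subseteq> cjoin F M \<beta> \<theta>"
    using cpower_subset_of_radical[OF \<alpha> cjoin_Con[OF Con(2) \<theta>]] le primes_above_cjoin by blast
  then obtain \<gamma> where \<gamma>: "\<gamma> \<in> fg_con F M" "\<gamma> \<subseteq> \<theta>" "cpower \<alpha> n \<subseteq> cjoin F M \<beta> \<gamma>"
    using compact_below_cjoin[OF cpower_fg_con[OF \<alpha>] Con(2) \<theta>] by blast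
  have "\<alpha> \<subseteq> \<phi>" if "\<phi> \<in> Spec F M" "\<beta> \<subseteq> \<phi>" "\<gamma> \<subseteq> \<phi>" for \<phi>
  proof (rule Spec_cpower[OF that(1) Con(1)])
    show "cpower \<alpha> n \<subseteq> \<phi>"
      using \<gamma>(3) that cjoin_subset_iff[OF SpecD(1)[OF that(1)], of \<beta> \<gamma>] by blast
  qed
  then have "primes_above F M \<beta> \<inter> primes_above F M \<gamma> \<subseteq> primes_above F M \<alpha>"
    by (intro subsetI) (simp add: primes_above_def)
  with \<gamma>(1,2) show ?thesis by blast
qed

text \<open>This is the congruence of the ideal \<open>star\<close>, read off on primes. The two
  inclusions yield two compact congruences below \<theta>, and their join serves both.\<close>

lemma primes_above_Int_eq_iff:
  assumes \<alpha>: "\<alpha> \<in> fg_con F M" and \<beta>: "\<beta> \<in> fg_con F M" and \<theta>: "\<theta> \<in> Con F M"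
  shows "primes_above F M \<alpha> \<inter> primes_above F M \<theta> = primes_above F M \<beta> \<inter> primes_above F M \<theta> \<longleftrightarrow>
    (\<exists>\<gamma>\<in>fg_con F M. \<gamma> \<subseteq> \<theta> \<and>
      primes_above F M \<alpha> \<inter> primes_above F M \<gamma> = primes_above F M \<beta> \<inter> primes_above F M \<gamma>)"
proof
  assume eq: "primes_above F M \<alpha> \<inter> primes_above F M \<theta> = primes_above F M \<beta> \<inter> primes_above F M \<theta>"
  obtain \<gamma> where \<gamma>: "\<gamma> \<in> fg_con F M" "\<gamma> \<subseteq> \<theta>"
    "primes_above F M \<beta> \<inter> primes_above F M \<gamma> \<subseteq> primes_above F M \<alpha>"
    using compact_below_radical[OF \<alpha> \<beta> \<theta>] eq by blast
  obtain \<gamma>' where \<gamma>': "\<gamma>' \<in> fg_con F M" "\<gamma>' \<subseteq> \<theta>"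
    "primes_above F M \<alpha> \<inter> primes_above F M \<gamma>' \<subseteq> primes_above F M \<beta>"
    using compact_below_radical[OF \<beta> \<alpha> \<theta>] eq by blast
  show "\<exists>\<gamma>\<in>fg_con F M. \<gamma> \<subseteq> \<theta> \<and>
      primes_above F M \<alpha> \<inter> primes_above F M \<gamma> = primes_above F M \<beta> \<inter> primes_above F M \<gamma>"
  proof (intro bexI conjI)
    show "cjoin F M \<gamma> \<gamma>' \<in> fg_con F M" using \<gamma>(1) \<gamma>'(1) by (rule cjoin_fg_con)
    show "cjoin F M \<gamma> \<gamma>' \<subseteq> \<theta>" using \<gamma>(2) \<gamma>'(2) by (simp add: cjoin_subset_iff[OF \<theta>])
    show "primes_above F M \<alpha> \<inter> primes_above F M (cjoin F M \<gamma> \<gamma>') =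
        primes_above F M \<beta> \<inter> primes_above F M (cjoin F M \<gamma> \<gamma>')"
      unfolding primes_above_cjoin using \<gamma>(3) \<gamma>'(3) by blast
  qed
next
  assume "\<exists>\<gamma>\<in>fg_con F M. \<gamma> \<subseteq> \<theta> \<and>
      primes_above F M \<alpha> \<inter> primes_above F M \<gamma> = primes_above F M \<beta> \<inter> primes_above F M \<gamma>"
  then obtain \<gamma> where "\<gamma> \<subseteq> \<theta>"
    "primes_above F M \<alpha> \<inter> primes_above F M \<gamma> = primes_above F M \<beta> \<inter> primes_above F M \<gamma>" by blast
  moreover from this(1) have "primes_above F M \<theta> \<subseteq> primes_above F M \<gamma>"
    unfolding primes_above_def by blast
  ultimately show "primes_above F M \<alpha> \<inter> primes_above F M \<theta> = primes_above F M \<beta> \<inter> primes_above F M \<theta>"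
    by blast
qed

text \<open>Quantifying over compact representatives lets \<open>reticulation_join\<close> and
  \<open>reticulation_meet\<close> rewrite; each law then becomes an identity between unions and
  intersections of sets of primes.\<close>

lemma reticulation_is_lattice: "is_lattice (reticulation F M)"
proof -
  have "is_lattice (reticulation F M) \<longleftrightarrow>
    (\<forall>\<alpha>\<in>fg_con F M. \<forall>\<beta>\<in>fg_con F M.
        let L = reticulation F M; x = hat F M \<alpha>; y = hat F M \<beta> in
        ljoin L x y \<in> carrier L \<and> lmeet L x y \<in> carrier L \<and>
        ljoin L x y = ljoin L y x \<and> lmeet L x y = lmeet L y x \<and>
        ljoin L x (lmeet L x y) = x \<and> lmeet L x (ljoin L x y) = x \<and>
        (\<forall>\<gamma>\<in>fg_con F M. let z = hat F M \<gamma> in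
          ljoin L (ljoin L x y) z = ljoin L x (ljoin L y z) \<and>
          lmeet L (lmeet L x y) z = lmeet L x (lmeet L y z)))"
    unfolding is_lattice_def Let_def reticulation_carrier by simp
  moreover note fg = cjoin_fg_con commutator_fg_con
  ultimately show ?thesis
    unfolding Let_def reticulation_carrier
    by (simp add: reticulation_join reticulation_meet fg hat_eq_iff fg_con_Con
        primes_above_cjoin primes_above_commutator Int_ac Un_ac Int_absorb1 Int_Un_distrib)
qed

end

section \<open>Prime congruences along a surjective homomorphism\<close>

context surj_hom
begin

text \<open>Descending to \<open>N\<close> uses \<open>commutator_pull_subset\<close>. For the
  converse, \<alpha> and \<beta> need not contain the kernel; joining both with
  \<open>pull \<phi>\<close> repairs this, and \<open>centralizes_cjoin\<close> says that the term
  condition survives the joins and can be pushed to \<open>N\<close>.\<close>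

lemma Spec_pull_iff:
  assumes "day_algebra F M" and \<phi>: "\<phi> \<in> Con F N"
  shows "pull \<phi> \<in> Spec F M \<longleftrightarrow> \<phi> \<in> Spec F N"
proof
  interpret day: day_algebra F M by fact
  have pull_nabla_N: "pull (nabla N) = nabla M" unfolding pull_def using h_closed by auto
  have ne: "pull \<phi> \<noteq> nabla M \<longleftrightarrow> \<phi> \<noteq> nabla N"
    using pull_nabla_N push_pull[OF Con_subset[OF \<phi>]] push_pull[of "nabla N"] by auto
  note \<phi>' = pull_Con[OF \<phi>] ker_subset_pull[OF \<phi>]
  show "\<phi> \<in> Spec F N" if "pull \<phi> \<in> Spec F M"
    unfolding Spec_def
  proof (intro CollectI conjI ballI impI)
    fix \<mu> \<nu> assume \<mu>\<nu>: "\<mu> \<in> Con F N" "\<nu> \<in> Con F N" and "commutator F N \<mu> \<nu> \<subseteq> \<phi>"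
    then have "commutator F M (pull \<mu>) (pull \<nu>) \<subseteq> pull \<phi>"
      using commutator_pull_subset[OF \<mu>\<nu>] pull_mono by blast
    then show "\<mu> \<subseteq> \<phi> \<or> \<nu> \<subseteq> \<phi>"
      using SpecD(3)[OF that pull_Con pull_Con] \<mu>\<nu> by (simp add: pull_subset_iff)
  qed (use \<phi> ne SpecD(2)[OF that] in auto)
  show "pull \<phi> \<in> Spec F M" if "\<phi> \<in> Spec F N"
    unfolding Spec_def
  proof (intro CollectI conjI ballI impI)
    fix \<alpha> \<beta> assume \<alpha>\<beta>: "\<alpha> \<in> Con F M" "\<beta> \<in> Con F M" and le: "commutator F M \<alpha> \<beta> \<subseteq> pull \<phi>"
    let ?\<alpha> = "cjoin F M (pull \<phi>) \<alpha>" and ?\<beta> = "cjoin F M (pull \<phi>) \<beta>"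
    note Con = dom.cjoin_Con[OF \<phi>'(1) \<alpha>\<beta>(1)] dom.cjoin_Con[OF \<phi>'(1) \<alpha>\<beta>(2)]
    have ker: "ker \<subseteq> ?\<alpha>" "ker \<subseteq> ?\<beta>" using \<phi>'(2) dom.cjoin_ge(1) by blast+
    note Con' = push_Con[OF Con(1) ker(1)] push_Con[OF Con(2) ker(2)]
    have "centralizes F N (push ?\<alpha>) (push ?\<beta>) \<phi>"
      by (intro centralizes_push day.centralizes_cjoin[OF \<alpha>\<beta> \<phi>'(1) le] Con Con_subset[OF Con(1)] Con_subset[OF Con(2)])
    then have "commutator F N (push ?\<alpha>) (push ?\<beta>) \<subseteq> \<phi>"
      by (rule cod.commutator_least[OF \<phi>])
    then have "push ?\<alpha> \<subseteq> \<phi> \<or> push ?\<beta> \<subseteq> \<phi>" using SpecD(3)[OF that Con'] by blast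
    then have "?\<alpha> \<subseteq> pull \<phi> \<or> ?\<beta> \<subseteq> pull \<phi>"
      using pull_subset_iff[OF Con'(1), of \<phi>] pull_subset_iff[OF Con'(2), of \<phi>]
      by (simp add: pull_push[OF Con(1) ker(1)] pull_push[OF Con(2) ker(2)])
    then show "\<alpha> \<subseteq> pull \<phi> \<or> \<beta> \<subseteq> pull \<phi>" using dom.cjoin_ge(2) by blast
  qed (use \<phi>' ne SpecD(2)[OF that] in auto)
qed

text \<open>A prime above \<open>pull \<mu>\<close> contains the kernel, so it is the pullback of
  its own image.\<close>

lemma primes_above_pull:
  assumes day: "day_algebra F M" and \<mu>: "\<mu> \<in> Con F N"
  shows "primes_above F M (pull \<mu>) = pull ` primes_above F N \<mu>"
proof (intro equalityI subsetI)
  fix \<psi> assume "\<psi> \<in> primes_above F M (pull \<mu>)"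
  then have \<psi>: "\<psi> \<in> Spec F M" "pull \<mu> \<subseteq> \<psi>" unfolding primes_above_def by auto
  then have ker: "ker \<subseteq> \<psi>" using ker_subset_pull[OF \<mu>] by blast
  note C = push_Con[OF SpecD(1)[OF \<psi>(1)] ker] and eq = pull_push[OF SpecD(1)[OF \<psi>(1)] ker]
  have "push \<psi> \<in> primes_above F N \<mu>"
    using Spec_pull_iff[OF day C] pull_subset_iff[OF \<mu>, of "push \<psi>"] \<psi> unfolding primes_above_def eq by blast
  then show "\<psi> \<in> pull ` primes_above F N \<mu>" using eq by (metis imageI)
next
  fix \<psi> assume "\<psi> \<in> pull ` primes_above F N \<mu>"
  then show "\<psi> \<in> primes_above F M (pull \<mu>)"
    using Spec_pull_iff[OF day] SpecD(1) pull_mono unfolding primes_above_def by blast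
qed

lemma primes_above_pull_eq_iff:
  assumes day: "day_algebra F M" and "\<mu> \<in> Con F N" "\<nu> \<in> Con F N"
  shows "primes_above F M (pull \<mu>) = primes_above F M (pull \<nu>) \<longleftrightarrow>
    primes_above F N \<mu> = primes_above F N \<nu>"
proof -
  have "inj_on pull (Con F N)"
    using pull_subset_iff by (intro inj_onI) (metis subset_antisym subset_refl)
  then show ?thesis
    unfolding primes_above_pull[OF day assms(2)] primes_above_pull[OF day assms(3)]
    by (rule inj_on_image_eq_iff) (auto simp: primes_above_def dest: SpecD(1))
qed

end

section \<open>Quotients of lattices\<close>

lemma is_lattice_image:
  assumes "is_lattice L" and onto: "f ` carrier L = carrier L'"
    and join: "\<And>x y. x \<in> carrier L \<Longrightarrow> y \<in> carrier L \<Longrightarrow> f (ljoin L x y) = ljoin L' (f x) (f y)"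
    and meet: "\<And>x y. x \<in> carrier L \<Longrightarrow> y \<in> carrier L \<Longrightarrow> f (lmeet L x y) = lmeet L' (f x) (f y)"
  shows "is_lattice L'"
proof -
  note L = assms(1)[unfolded is_lattice_def, rule_format]
  have closed: "ljoin L x y \<in> carrier L" "lmeet L x y \<in> carrier L" if "x \<in> carrier L" "y \<in> carrier L" for x y
    using L that by blast+
  show ?thesis
    unfolding is_lattice_def onto[symmetric]
    by (clarsimp simp: join[symmetric] meet[symmetric] closed;
        intro conjI ballI arg_cong[where f = f]; use L in blast)
qed

text \<open>The homomorphism theorem: by the hypothesis on \<open>f x = f y\<close>, the classes of
  \<open>ideal_rel\<close> are the fibres of \<open>f\<close>, and the isomorphism \<open>h\<close>
  sends a point of \<open>L'\<close> to its fibre.\<close>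

lemma lattice_isomorphic_quotient:
  assumes L: "is_lattice L" and onto: "f ` carrier L = carrier L'"
    and join: "\<And>x y. x \<in> carrier L \<Longrightarrow> y \<in> carrier L \<Longrightarrow> f (ljoin L x y) = ljoin L' (f x) (f y)"
    and meet: "\<And>x y. x \<in> carrier L \<Longrightarrow> y \<in> carrier L \<Longrightarrow> f (lmeet L x y) = lmeet L' (f x) (f y)"
    and ker: "\<And>x y. x \<in> carrier L \<Longrightarrow> y \<in> carrier L \<Longrightarrow> f x = f y \<longleftrightarrow> (\<exists>i\<in>I. ljoin L x i = ljoin L y i)"
  shows "lattice_isomorphic L' (quotient_lattice L I)"
proof -
  let ?Q = "quotient_lattice L I"
  define h where "h y = {x \<in> carrier L. f x = y}" for y
  have closed: "ljoin L x y \<in> carrier L" "lmeet L x y \<in> carrier L" if "x \<in> carrier L" "y \<in> carrier L" for x y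
    using L that unfolding is_lattice_def by blast+
  have "ideal_rel L I = {(x, y). x \<in> carrier L \<and> y \<in> carrier L \<and> f x = f y}"
    unfolding ideal_rel_def using ker by blast
  then have cls: "ideal_rel L I `` {x} = h (f x)" if "x \<in> carrier L" for x
    using that unfolding h_def by auto
  have Q: "carrier ?Q = h ` carrier L'"
    unfolding quotient_lattice_def quotient_def onto[symmetric] by (auto simp: cls)
  have L': "is_lattice L'" using is_lattice_image[OF L onto join meet] .
  have UN: "(\<Union>x\<in>h (f a). \<Union>y\<in>h (f b). ideal_rel L I `` {op x y}) = h (f (op a b))"
    if "a \<in> carrier L" "b \<in> carrier L" "\<And>x y. x \<in> carrier L \<Longrightarrow> y \<in> carrier L \<Longrightarrow> op x y \<in> carrier L"
      "\<And>x y. x \<in> carrier L \<Longrightarrow> y \<in> carrier L \<Longrightarrow> f (op x y) = op' (f x) (f y)" for a b op op'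
  proof -
    have "ideal_rel L I `` {op x y} = h (f (op a b))" if "x \<in> h (f a)" "y \<in> h (f b)" for x y
      using that \<open>a \<in> carrier L\<close> \<open>b \<in> carrier L\<close>
        \<open>\<And>x y. x \<in> carrier L \<Longrightarrow> y \<in> carrier L \<Longrightarrow> op x y \<in> carrier L\<close>
        \<open>\<And>x y. x \<in> carrier L \<Longrightarrow> y \<in> carrier L \<Longrightarrow> f (op x y) = op' (f x) (f y)\<close>
      by (auto simp: h_def cls)
    moreover have "a \<in> h (f a)" "b \<in> h (f b)" using that(1,2) by (auto simp: h_def)
    ultimately show ?thesis by blast
  qed
  have h_join: "h (ljoin L' x y) = ljoin ?Q (h x) (h y)" and h_meet: "h (lmeet L' x y) = lmeet ?Q (h x) (h y)"
    if xy: "x \<in> carrier L'" "y \<in> carrier L'" for x y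
  proof -
    obtain a b where ab: "a \<in> carrier L" "b \<in> carrier L" "x = f a" "y = f b"
      using xy unfolding onto[symmetric] by blast
    show "h (ljoin L' x y) = ljoin ?Q (h x) (h y)"
      using UN[of a b "ljoin L" "ljoin L'"] ab closed join by (simp add: quotient_lattice_def)
    show "h (lmeet L' x y) = lmeet ?Q (h x) (h y)"
      using UN[of a b "lmeet L" "lmeet L'"] ab closed meet by (simp add: quotient_lattice_def)
  qed
  have "inj_on h (carrier L')"
    unfolding onto[symmetric] by (rule inj_onI) (auto simp: h_def)
  then have "bij_betw h (carrier L') (carrier ?Q)" unfolding bij_betw_def Q by blast
  moreover have "is_lattice ?Q" using is_lattice_image[OF L' Q[symmetric]] h_join h_meet by blast
  ultimately show ?thesis
    unfolding lattice_isomorphic_def using L' h_join h_meet by blast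
qed

section \<open>The reticulation of a quotient\<close>

text \<open>The closure hypothesis is available only for carriers in the type \<open>'b\<close>. The
  structure of \<open>A\<close> is copied along the injection \<open>e\<close>, and compact
  congruences and commutators are moved to the copy and back.\<close>

lemma transport_commutator_fg_con:
  fixes A :: "('f, 'a) algebra" and e :: "'a \<Rightarrow> 'b"
  assumes e: "inj e" and A: "A \<in> variety F E" and wfE: "wf_identities F E"
    and fg: "\<And>M \<alpha> \<beta>. M \<in> (variety F E :: ('f, 'b) algebra set) \<Longrightarrow> \<alpha> \<in> fg_con F M \<Longrightarrow> \<beta> \<in> fg_con F M \<Longrightarrow>
      commutator F M \<alpha> \<beta> \<in> fg_con F M"
    and \<alpha>: "\<alpha> \<in> fg_con F A" and \<beta>: "\<beta> \<in> fg_con F A"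
  shows "commutator F A \<alpha> \<beta> \<in> fg_con F A"
proof -
  define M where "M = \<lparr>carrier = e ` carrier A, interp = \<lambda>f ys. e (interp A f (map (inv e) ys))\<rparr>"
  interpret surj_hom F A M e
  proof unfold_locales
    show "is_algebra F A" using A unfolding variety_def by blast
  qed (use e in \<open>simp_all add: M_def o_def\<close>)
  have ker: "ker \<subseteq> Id" using e unfolding ker_def by (auto dest: injD)
  have join: "cjoin F A \<gamma> ker = \<gamma>" if "\<gamma> \<in> Con F A" for \<gamma>
  proof -
    have "ker \<subseteq> \<gamma>" using ker Con_refl[OF that] unfolding ker_def by auto
    then show ?thesis using dom.cjoin_ge(1) dom.cjoin_subset_iff[OF that] by blast
  qed
  have push: "push \<gamma> \<in> fg_con F M" if \<gamma>: "\<gamma> \<in> fg_con F A" for \<gamma>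
  proof -
    obtain \<nu> where "\<nu> \<in> fg_con F M" "pull \<nu> = \<gamma>"
      using fg_con_push[OF \<gamma>] join[OF dom.fg_con_Con[OF \<gamma>]] by auto
    then show ?thesis using push_pull[OF Con_subset[OF cod.fg_con_Con[of \<nu>]]] by simp
  qed
  have "commutator F M (push \<alpha>) (push \<beta>) \<in> fg_con F M"
    using fg variety_image[OF A wfE] push \<alpha> \<beta> by blast
  then obtain \<gamma> where "\<gamma> \<in> fg_con F A" "pull (commutator F M (push \<alpha>) (push \<beta>)) = cjoin F A \<gamma> ker"
    using fg_con_pull by blast
  then show ?thesis
    using join[OF dom.fg_con_Con] commutator_push[OF ker] dom.fg_con_Con[OF \<alpha>] dom.fg_con_Con[OF \<beta>] by simp
qed

lemma (in compact_commutator_algebra) reticulation_quotient: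
  assumes \<theta>: "\<theta> \<in> Con F M"
  shows "lattice_isomorphic (reticulation F (quotient_algebra M \<theta>))
    (quotient_lattice (reticulation F M) (star F M \<theta>))"
proof -
  let ?N = "quotient_algebra M \<theta>"
  interpret surj_hom F M ?N "\<lambda>x. \<theta> `` {x}" by (rule quotient_surj_hom[OF is_algebra \<theta>])
  have ker: "ker = \<theta>" by (rule quotient_ker[OF is_algebra \<theta>])
  note day = day_algebra_axioms
  let ?V = "primes_above F M"
  \<comment> \<open>V(\<alpha>) \<inter> V(\<theta>) is the set of primes above the join of \<alpha>
    and \<theta>, so \<open>f\<close> sends the class of \<alpha> to the class of the image of that
    join in A/\<theta>. Phrased with primes, it depends only on the class.\<close>
  define f where "f X = {\<mu> \<in> Con F ?N. \<exists>\<alpha>\<in>X. ?V (pull \<mu>) = ?V \<alpha> \<inter> ?V \<theta>}" for X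
  have f: "f (hat F M \<alpha>) = {\<mu> \<in> Con F ?N. ?V (pull \<mu>) = ?V \<alpha> \<inter> ?V \<theta>}" if "\<alpha> \<in> Con F M" for \<alpha>
    using that unfolding f_def hat_eq[OF that] by blast
  have f_hat: "f (hat F M \<alpha>) = hat F ?N \<nu>"
    if "\<alpha> \<in> Con F M" "\<nu> \<in> Con F ?N" "?V (pull \<nu>) = ?V \<alpha> \<inter> ?V \<theta>" for \<alpha> \<nu>
    unfolding f[OF that(1)] cod.hat_eq[OF that(2)] that(3)[symmetric]
    using primes_above_pull_eq_iff[OF day _ that(2)] by blast
  have push: "\<exists>\<nu>\<in>fg_con F ?N. ?V (pull \<nu>) = ?V \<alpha> \<inter> ?V \<theta>" if "\<alpha> \<in> fg_con F M" for \<alpha>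
    using fg_con_push[OF that] primes_above_cjoin unfolding ker by metis
  have pull: "\<exists>\<alpha>\<in>fg_con F M. ?V (pull \<nu>) = ?V \<alpha> \<inter> ?V \<theta>" if "\<nu> \<in> fg_con F ?N" for \<nu>
    using fg_con_pull[OF that] primes_above_cjoin unfolding ker by metis
  show ?thesis
  proof (rule lattice_isomorphic_quotient[OF reticulation_is_lattice, of f])
    show "f ` carrier (reticulation F M) = carrier (reticulation F ?N)"
      unfolding reticulation_carrier cod.reticulation_carrier
    proof (intro equalityI subsetI)
      fix X assume "X \<in> f ` hat F M ` fg_con F M"
      then obtain \<alpha> where \<alpha>: "\<alpha> \<in> fg_con F M" "X = f (hat F M \<alpha>)" by blast
      then show "X \<in> hat F ?N ` fg_con F ?N"
        using push[OF \<alpha>(1)] f_hat[OF fg_con_Con[OF \<alpha>(1)] cod.fg_con_Con] by blast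
    next
      fix X assume "X \<in> hat F ?N ` fg_con F ?N"
      then obtain \<nu> where \<nu>: "\<nu> \<in> fg_con F ?N" "X = hat F ?N \<nu>" by blast
      then show "X \<in> f ` hat F M ` fg_con F M"
        using pull[OF \<nu>(1)] f_hat[OF fg_con_Con cod.fg_con_Con[OF \<nu>(1)]] by blast
    qed
  next
    fix X Y assume "X \<in> carrier (reticulation F M)" "Y \<in> carrier (reticulation F M)"
    then obtain \<alpha> \<beta> where \<alpha>: "\<alpha> \<in> fg_con F M" "X = hat F M \<alpha>" and \<beta>: "\<beta> \<in> fg_con F M" "Y = hat F M \<beta>"
      unfolding reticulation_carrier by blast
    note Con = fg_con_Con[OF \<alpha>(1)] fg_con_Con[OF \<beta>(1)]
    obtain \<mu> \<nu> where \<mu>: "\<mu> \<in> fg_con F ?N" "?V (pull \<mu>) = ?V \<alpha> \<inter> ?V \<theta>"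
      and \<nu>: "\<nu> \<in> fg_con F ?N" "?V (pull \<nu>) = ?V \<beta> \<inter> ?V \<theta>"
      using push[OF \<alpha>(1)] push[OF \<beta>(1)] by blast
    note ConN = cod.fg_con_Con[OF \<mu>(1)] cod.fg_con_Con[OF \<nu>(1)]
    have fXY: "f X = hat F ?N \<mu>" "f Y = hat F ?N \<nu>"
      unfolding \<alpha>(2) \<beta>(2) using f_hat Con ConN \<mu>(2) \<nu>(2) by blast+
    have "?V (pull (cjoin F ?N \<mu> \<nu>)) = ?V (cjoin F M \<alpha> \<beta>) \<inter> ?V \<theta>"
      unfolding pull_cjoin[OF ConN] primes_above_cjoin \<mu>(2) \<nu>(2) by blast
    then show "f (ljoin (reticulation F M) X Y) = ljoin (reticulation F ?N) (f X) (f Y)"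
      unfolding fXY unfolding \<alpha>(2) \<beta>(2) reticulation_join[OF \<alpha>(1) \<beta>(1)] cod.reticulation_join[OF \<mu>(1) \<nu>(1)]
      using f_hat[OF cjoin_Con[OF Con] cod.cjoin_Con[OF ConN]] by blast
    \<comment> \<open>The meet is compared on primes: direct images commute with unions, so the
      commutators of \<open>M\<close> and of the quotient never have to be matched as
      congruences.\<close>
    have "?V (pull (commutator F ?N \<mu> \<nu>)) = ?V (pull \<mu>) \<union> ?V (pull \<nu>)"
      unfolding primes_above_pull[OF day cod.commutator_Con[OF ConN]] primes_above_pull[OF day ConN(1)]
        primes_above_pull[OF day ConN(2)] cod.primes_above_commutator[OF ConN] by blast
    also have "\<dots> = ?V (commutator F M \<alpha> \<beta>) \<inter> ?V \<theta>"
      unfolding primes_above_commutator[OF Con] \<mu>(2) \<nu>(2) by blast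
    finally show "f (lmeet (reticulation F M) X Y) = lmeet (reticulation F ?N) (f X) (f Y)"
      unfolding fXY unfolding \<alpha>(2) \<beta>(2) reticulation_meet[OF \<alpha>(1) \<beta>(1)] cod.reticulation_meet[OF \<mu>(1) \<nu>(1)]
      using f_hat[OF commutator_Con[OF Con] cod.commutator_Con[OF ConN]] by blast
    have "f X = f Y \<longleftrightarrow> primes_above F ?N \<mu> = primes_above F ?N \<nu>"
      unfolding fXY cod.hat_eq_iff[OF ConN] ..
    also have "\<dots> \<longleftrightarrow> ?V \<alpha> \<inter> ?V \<theta> = ?V \<beta> \<inter> ?V \<theta>"
      unfolding primes_above_pull_eq_iff[OF day ConN, symmetric] \<mu>(2) \<nu>(2) ..
    also have "\<dots> \<longleftrightarrow> (\<exists>\<gamma>\<in>fg_con F M. \<gamma> \<subseteq> \<theta> \<and> ?V \<alpha> \<inter> ?V \<gamma> = ?V \<beta> \<inter> ?V \<gamma>)"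
      by (rule primes_above_Int_eq_iff[OF \<alpha>(1) \<beta>(1) \<theta>])
    also have "\<dots> \<longleftrightarrow> (\<exists>\<gamma>\<in>fg_con F M. \<gamma> \<subseteq> \<theta> \<and> ljoin (reticulation F M) X (hat F M \<gamma>) =
        ljoin (reticulation F M) Y (hat F M \<gamma>))"
      unfolding \<alpha>(2) \<beta>(2)
      by (intro bex_cong conj_cong refl)
        (simp add: reticulation_join \<alpha>(1) \<beta>(1) hat_eq_iff cjoin_Con Con fg_con_Con primes_above_cjoin)
    also have "\<dots> \<longleftrightarrow> (\<exists>i\<in>star F M \<theta>. ljoin (reticulation F M) X i = ljoin (reticulation F M) Y i)"
      unfolding star_def by blast
    finally show "f X = f Y \<longleftrightarrow>
        (\<exists>i\<in>star F M \<theta>. ljoin (reticulation F M) X i = ljoin (reticulation F M) Y i)" .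
  qed
qed

theorem proposition9p6:
  fixes F :: "('f \<times> nat) set"
    and E :: "'f identities"
    and A :: "('f, 'a) algebra"
    and \<theta> :: "'a rel"
  defines "\<C> \<equiv> (variety F E :: ('f, ('f, 'a) universe) algebra set)"
  assumes "wf_identities F E"
    and "congruence_modular F \<C>"
    and "semi_degenerate F \<C>"
    and "\<And>M \<alpha> \<beta>. M \<in> \<C> \<Longrightarrow> \<alpha> \<in> fg_con F M \<Longrightarrow> \<beta> \<in> fg_con F M \<Longrightarrow> commutator F M \<alpha> \<beta> \<in> fg_con F M"
    and "A \<in> variety F E"
    and "\<theta> \<in> Con F A"
  shows "lattice_isomorphic (reticulation F (quotient_algebra A \<theta>))
           (quotient_lattice (reticulation F A) (star F A \<theta>))"
proof -
  have "is_algebra F A" using assms(6) unfolding variety_def by blast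
  then interpret univ_algebra F A by unfold_locales
  \<comment> \<open>A point of \<open>A\<close> is represented in \<open>universe\<close> by the
    singleton of its generator; this is the injection along which the commutator hypothesis is
    transported.\<close>
  have "inj (\<lambda>a. {Var (Inl a)} :: ('f, 'a) universe)" by (rule injI) simp
  then interpret compact_commutator_algebra F A
    using modular_day_walk[OF assms(2) assms(3)[unfolded \<C>_def] assms(6)]
      transport_commutator_fg_con[OF _ assms(6,2) assms(5)[unfolded \<C>_def]]
    by unfold_locales blast+
  show ?thesis using assms(7) by (rule reticulation_quotient)
qed

end
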